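(* Let $0<\lambda<1/2$. Let $K_\lambda\subset[0,1]$ be the unique nonempty compact set with $K_\lambda=\lambda K_\lambda\cup(\lambda K_\lambda+1-\lambda)$, let $C_\lambda=K_\lambda\times K_\lambda$, let $S^1=\{(x,y)\in\mathbb{R}^2:x^2+y^2=1\}$, and let $A_\lambda=C_\lambda+S^1$. Then $A_\lambda$ has nonempty interior in $\mathbb{R}^2$ if and only if $\lambda>1/4$.
   Context: For $F,\Gamma\subset\mathbb{R}^2$, the Minkowski sum is $F+\Gamma=\{x+y:x\in F,\ y\in\Gamma\}$. *)

theory Defs
  imports "HOL-Analysis.Analysis" "HOL-Library.Set_Algebras"
begin

definition self_similar :: "real \<Rightarrow> real set \<Rightarrow> bool" where
  "self_similar r K \<longleftrightarrow> K = (\<lambda>x. r * x) ` K \<union> (\<lambda>x. r * x + 1 - r) ` K"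

text \<open>Well defined for \<open>0 < r < 1/2\<close>: see \<open>ex1_cantor_K\<close> and \<open>cantor_K_subset\<close> below.\<close>

definition cantor_K :: "real \<Rightarrow> real set" where
  "cantor_K r = (THE K. K \<noteq> {} \<and> compact K \<and> self_similar r K)"

definition cantor_C :: "real \<Rightarrow> (real \<times> real) set" where
  "cantor_C r = cantor_K r \<times> cantor_K r"

definition unit_circle :: "(real \<times> real) set" where
  "unit_circle = {(x, y). x\<^sup>2 + y\<^sup>2 = 1}"

text \<open>On sets, \<open>+\<close> is the Minkowski sum (\<open>set_plus_def\<close>).\<close>

definition cantor_A :: "real \<Rightarrow> (real \<times> real) set" where
  "cantor_A r = cantor_C r + unit_circle"

lemma self_similar_subset:
  fixes r :: real
  assumes r: "0 < r" "r < 1"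
    and K: "compact K" "self_similar r K"
    and L: "L \<noteq> {}" "compact L" "self_similar r L"
  shows "K \<subseteq> L"
proof (cases "K = {}")
  case False
  have "continuous_on K (\<lambda>x. infdist x L)"
    by (intro continuous_intros)
  then obtain x where x: "x \<in> K" and mx: "\<And>y. y \<in> K \<Longrightarrow> infdist y L \<le> infdist x L"
    using continuous_attains_sup[OF K(1) False] by blast
  have "x \<in> (\<lambda>x. r * x) ` K \<union> (\<lambda>x. r * x + 1 - r) ` K"
    using x K(2) unfolding self_similar_def by blast
  then obtain y b where y: "y \<in> K" "x = r * y + b" "b = 0 \<or> b = 1 - r"
  proof (rule UnE)
    assume "x \<in> (\<lambda>x. r * x) ` K"
    then obtain y where "y \<in> K" "x = r * y" by blast
    then show ?thesis using that[of y 0] by simp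
  next
    assume "x \<in> (\<lambda>x. r * x + 1 - r) ` K"
    then obtain y where "y \<in> K" "x = r * y + 1 - r" by blast
    then show ?thesis using that[of y "1 - r"] by simp
  qed
  obtain z where z: "z \<in> L" "infdist y L = dist y z"
    using infdist_attains_inf[OF compact_imp_closed[OF L(2)] L(1)] by blast
  have "r * z \<in> L" "r * z + 1 - r \<in> L"
    using z(1) L(3) unfolding self_similar_def by blast+
  then have "r * z + b \<in> L" using y(3) by (elim disjE) (simp_all add: add_diff_eq)
  then have "infdist x L \<le> dist x (r * z + b)" by (rule infdist_le)
  also have "\<dots> = \<bar>r * (y - z)\<bar>" by (simp add: y(2) dist_real_def algebra_simps)
  also have "\<dots> = r * dist y z" using r by (simp add: dist_real_def abs_mult)
  also have "\<dots> \<le> r * infdist x L" using mx[OF y(1)] z(2) r by simp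
  finally have "(1 - r) * infdist x L \<le> 0" by (simp add: algebra_simps)
  then have "infdist x L \<le> 0" using r by (simp add: mult_le_0_iff)
  then have "infdist y L = 0" if "y \<in> K" for y
    using mx[OF that] infdist_nonneg[of y L] by linarith
  then show ?thesis
    using in_closed_iff_infdist_zero[OF compact_imp_closed[OF L(2)] L(1)] by blast
qed simp

lemma ex_self_similar:
  fixes r :: real
  assumes r: "0 < r" "r < 1/2"
  shows "\<exists>K. K \<noteq> {} \<and> compact K \<and> self_similar r K \<and> K \<subseteq> {0..1}"
proof -
  define f g :: "real \<Rightarrow> real" where "f = (\<lambda>x. r * x)" and "g = (\<lambda>x. r * x + 1 - r)"
  define H where "H = (\<lambda>E. f ` E \<union> g ` E)"
  define E where "E n = (H ^^ n) {0..1}" for n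
  define K where "K = (\<Inter>n. E n)"
  have E0: "E 0 = {0..1}" and ES: "E (Suc n) = H (E n)" for n by (auto simp: E_def)
  have Hm: "H A \<subseteq> H B" if "A \<subseteq> B" for A B using that by (auto simp: H_def)
  have "0 \<le> r * x \<and> r * x \<le> r" if "0 \<le> x" "x \<le> 1" for x
    using mult_left_le[of x r] that r by simp
  then have "f x \<in> {0..1} \<and> g x \<in> {0..1}" if "x \<in> {0..1}" for x
    using that r unfolding f_def g_def by (smt (verit) atLeastAtMost_iff field_sum_of_halves)
  then have H0: "H {0..1} \<subseteq> {0..1}" unfolding H_def by blast
  have step: "E (Suc n) \<subseteq> E n" for n
    by (induction n) (use H0 Hm in \<open>auto simp: E0 ES\<close>)
  have dec: "m \<le> n \<Longrightarrow> E n \<subseteq> E m" for m n by (rule lift_Suc_antimono_le[of E]) (use step in auto)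
  have comp: "compact (E n)" for n
  proof (induction n)
    case (Suc n)
    then show ?case unfolding ES H_def f_def g_def
      by (intro compact_Un compact_continuous_image continuous_intros)
  qed (simp add: E0)
  have zero: "0 \<in> E n" for n
    by (induction n) (auto simp: E0 ES H_def f_def)
  have inj: "inj f" "inj g" using r by (auto simp: inj_def f_def g_def)
  have "H K \<subseteq> K"
  proof -
    have "H K \<subseteq> E n" for n
      using Hm[of K "E n"] step[of n] by (auto simp: K_def ES)
    then show ?thesis by (auto simp: K_def)
  qed
  moreover have "K \<subseteq> H K"
  proof
    fix x assume "x \<in> K"
    then have x: "x \<in> f ` E n \<or> x \<in> g ` E n" for n
      using ES[of n] by (auto simp: K_def H_def)
    have "(\<forall>n. x \<in> f ` E n) \<or> (\<forall>n. x \<in> g ` E n)"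
    proof (rule ccontr)
      assume "\<not> ?thesis"
      then obtain m n where "x \<notin> f ` E m" "x \<notin> g ` E n" by blast
      then show False using x[of "max m n"] dec[of m "max m n"] dec[of n "max m n"] by auto
    qed
    then have "x \<in> (\<Inter>n. f ` E n) \<or> x \<in> (\<Inter>n. g ` E n)" by blast
    then show "x \<in> H K"
      using image_INT[of f UNIV UNIV E] image_INT[of g UNIV UNIV E] inj by (auto simp: H_def K_def)
  qed
  ultimately have "self_similar r K" by (auto simp: self_similar_def H_def f_def g_def)
  moreover have "compact K" unfolding K_def by (rule compact_Inter) (use comp in auto)
  moreover have "K \<noteq> {}" "K \<subseteq> {0..1}" using zero E0 by (auto simp: K_def)
  ultimately show ?thesis by blast
qed

lemma ex1_cantor_K:
  fixes r :: real
  assumes "0 < r" "r < 1/2"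
  shows "\<exists>!K. K \<noteq> {} \<and> compact K \<and> self_similar r K"
proof -
  have "r < 1" using assms by simp
  note sub = self_similar_subset[OF assms(1) this]
  obtain K where K: "K \<noteq> {}" "compact K" "self_similar r K"
    using ex_self_similar[OF assms] by blast
  show ?thesis
  proof (rule ex1I[of _ K])
    fix L assume "L \<noteq> {} \<and> compact L \<and> self_similar r L"
    then show "L = K" using sub[of L K] sub[of K L] K by blast
  qed (use K in simp)
qed

lemma cantor_K:
  fixes r :: real
  assumes "0 < r" "r < 1/2"
  shows "cantor_K r \<noteq> {}" "compact (cantor_K r)" "self_similar r (cantor_K r)"
  using theI'[OF ex1_cantor_K[OF assms]] unfolding cantor_K_def by blast+

lemma cantor_K_subset:
  fixes r :: real
  assumes "0 < r" "r < 1/2"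
  shows "cantor_K r \<subseteq> {0..1}"
  using ex_self_similar[OF assms] ex1_cantor_K[OF assms] cantor_K[OF assms] by metis

end

theory Submission
  imports Defs
begin

text \<open>
  Write \<open>K\<close> for the Cantor set of ratio \<open>r\<close> and \<open>C = K \<times> K\<close>. A point \<open>c\<close> lies in \<open>C + S\<^sup>1\<close> iff the unit
  circle around \<open>c\<close> meets \<open>C\<close>, and at a small square of the construction of \<open>C\<close> this circle is nearly
  a straight line. So everything depends on how the four corner squares inside a square project along
  a direction.

  \<^emph>\<open>Ratio above 1/4.\<close> Along a direction of slope about \<open>-1/2\<close> the hulls of the four corner squares
  project to four equally spaced intervals, and these overlap exactly when \<open>r \<ge> 1/4\<close>. For \<open>r > 1/4\<close>
  the overlap survives small changes of direction, so a circle that crosses a small square at about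
  that slope also crosses one of its corner squares (\<open>circle_descends\<close>), hence by iteration and
  compactness it meets \<open>C\<close> (\<open>circle_meets_cantor_C\<close>). Crossing a fixed square is an open condition on
  the centre, which gives an open subset of \<open>C + S\<^sup>1\<close>.

  \<^emph>\<open>Ratio at most 1/4.\<close> Here \<open>C + S\<^sup>1\<close> is a null set. Almost every shadow \<open>K + t K\<close> is null. For
  \<open>r < 1/4\<close> that is immediate, because a shadow consists of four copies of itself scaled by \<open>r\<close>. For
  \<open>r = 1/4\<close> a shadow of positive measure would be tiled by its cylinders without overlap, so no two
  cylinders of equal level can lie almost on top of each other relative to their size
  (\<open>shadow_null_of_small_differences\<close>). Such near coincidences are the inequalities
  \<open>\<bar>a + t b\<bar> < \<epsilon>\<close> with \<open>a\<close>, \<open>b\<close> not both zero and having base 4 digits in \<open>{-1, 0, 1}\<close>. The ratios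
  \<open>-a/b\<close> are so dense at every scale that the directions without a near coincidence form a porous,
  hence null, set (\<open>separated_negligible\<close>).

  To pass from lines to circles, cut \<open>C\<close> into its \<open>4\<^sup>m\<close> squares of side \<open>r\<^sup>m\<close>. On a horizontal line the sum
  of one square with an arc is a copy of a shadow scaled by \<open>r\<^sup>m\<close>, up to an error of order
  \<open>r\<^sup>2\<^sup>m\<close> caused by curvature. By Fubini the area of \<open>C\<close> plus an arc is at most \<open>(4 r)\<^sup>m \<le> 1\<close> times the area
  of the \<open>O(r\<^sup>m)\<close>-thickening of the compact set of all pairs of a direction and a point of its shadow.
  As \<open>m\<close> grows this tends to the area of that set itself, which is zero (\<open>octant_sum_negligible\<close>).
\<close>

section \<open>Cylinders of the Cantor set\<close>

lemma cantor_K_child: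
  fixes r :: real
  assumes "0 < r" "r < 1/2" "x \<in> cantor_K r"
  shows "r * x \<in> cantor_K r" "r * x + 1 - r \<in> cantor_K r"
  using cantor_K(3)[OF assms(1,2)] assms(3) unfolding self_similar_def by blast+

lemma zero_in_cantor_K:
  fixes r :: real
  assumes r: "0 < r" "r < 1/2"
  shows "0 \<in> cantor_K r"
proof -
  obtain m where m: "m \<in> cantor_K r" "\<And>x. x \<in> cantor_K r \<Longrightarrow> m \<le> x"
    using compact_attains_inf[OF cantor_K(2)[OF r] cantor_K(1)[OF r]] by blast
  have "m \<le> r * m" using m cantor_K_child(1)[OF r m(1)] by blast
  moreover have "m \<ge> 0" using cantor_K_subset[OF r] m(1) by auto
  ultimately have "m = 0" using r mult_strict_right_mono[of r 1 m] by fastforce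
  then show ?thesis using m(1) by simp
qed

text \<open>The reflected set is self-similar for the same ratio.\<close>

lemma cantor_K_reflect:
  fixes r :: real
  assumes r: "0 < r" "r < 1/2" and x: "x \<in> cantor_K r"
  shows "1 - x \<in> cantor_K r"
proof -
  let ?K = "cantor_K r" and ?L = "(\<lambda>x. 1 - x) ` cantor_K r"
  have "compact ?L"
    by (intro compact_continuous_image continuous_intros cantor_K(2)[OF r])
  moreover have "self_similar r ?L"
  proof -
    have "?L = (\<lambda>x. 1 - x) ` ((\<lambda>x. r * x) ` ?K \<union> (\<lambda>x. r * x + 1 - r) ` ?K)"
      using cantor_K(3)[OF r] unfolding self_similar_def by simp
    also have "\<dots> = (\<lambda>x. r * x) ` ?L \<union> (\<lambda>x. r * x + 1 - r) ` ?L"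
      unfolding image_Un image_image by (simp add: algebra_simps Un_commute)
    finally show ?thesis unfolding self_similar_def .
  qed
  ultimately have "?L \<subseteq> ?K"
    using self_similar_subset[of r ?L ?K] r cantor_K[OF r] by auto
  then show ?thesis using x by blast
qed

text \<open>Left end points of the level \<open>n\<close> intervals of the construction. The recursion appends the digit of
  smallest weight, so that each level refines the previous one.\<close>

primrec corners :: "real \<Rightarrow> nat \<Rightarrow> real set" where
  "corners r 0 = {0}"
| "corners r (Suc n) = corners r n \<union> (\<lambda>p. p + r ^ n * (1 - r)) ` corners r n"

lemma finite_corners [simp]: "finite (corners r n)"
  by (induction n) auto

lemma card_corners_le: "card (corners r n) \<le> 2 ^ n"
proof (induction n)
  case (Suc n)
  have "card (corners r (Suc n)) \<le> card (corners r n) + card ((\<lambda>p. p + r ^ n * (1 - r)) ` corners r n)"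
    by (simp add: card_Un_le)
  also have "\<dots> \<le> 2 ^ n + 2 ^ n"
    using Suc card_image_le[OF finite_corners, of "\<lambda>p. p + r ^ n * (1 - r)" r n] by linarith
  finally show ?case by simp
qed simp

lemma cantor_K_cylinders:
  fixes r :: real
  assumes r: "0 < r" "r < 1/2"
  shows "cantor_K r = (\<Union>p\<in>corners r n. (\<lambda>x. p + r ^ n * x) ` cantor_K r)"
proof (induction n)
  case (Suc n)
  let ?K = "cantor_K r"
  have *: "(\<lambda>x. p + r ^ n * x) ` ?K = (\<lambda>x. p + r ^ Suc n * x) ` ?K
        \<union> (\<lambda>x. (p + r ^ n * (1 - r)) + r ^ Suc n * x) ` ?K" for p
  proof -
    have "(\<lambda>x. p + r ^ n * x) ` ?K =
        (\<lambda>x. p + r ^ n * x) ` ((\<lambda>x. r * x) ` ?K \<union> (\<lambda>x. r * x + 1 - r) ` ?K)"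
      using cantor_K(3)[OF r] unfolding self_similar_def by simp
    then show ?thesis unfolding image_Un image_image by (simp add: algebra_simps)
  qed
  have "?K = (\<Union>p\<in>corners r n. (\<lambda>x. p + r ^ n * x) ` ?K)" by (rule Suc)
  also have "\<dots> = (\<Union>p\<in>corners r (Suc n). (\<lambda>x. p + r ^ Suc n * x) ` ?K)"
    unfolding * by (simp add: UN_Un UN_Un_distrib image_Un)
  finally show ?case .
qed simp


section \<open>Ratios above one quarter\<close>

text \<open>To the right of and above \<open>(a, b)\<close>, where \<open>F\<close> increases in both variables, its zero set crosses a
  square iff \<open>F\<close> changes sign between the lower left and the upper right vertex. Order the
  four corner squares as lower left, lower right, upper left, upper right. The slope condition makes
  \<open>F\<close> at the lower left vertex of each at most \<open>F\<close> at the upper right vertex of its predecessor, so the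
  sign changes in one of them.\<close>

lemma circle_descends:
  fixes r :: real
  assumes r: "0 < r" "r < 1/2" and s: "s > 0"
    and slope: "(1 - 2 * r) * (p - a + s) \<le> r * (q - b)" "(1 - 2 * r) * (q - b + s) \<le> p - a"
    and F: "\<And>x y. F x y = (x - a)\<^sup>2 + (y - b)\<^sup>2 - 1"
    and sgn: "F p q \<le> 0" "0 \<le> F (p + s) (q + s)"
  shows "\<exists>p' q'. p' \<in> {p, p + (1 - r) * s} \<and> q' \<in> {q, q + (1 - r) * s} \<and>
     F p' q' \<le> 0 \<and> 0 \<le> F (p' + r * s) (q' + r * s)"
proof -
  define X Y where "X = p - a" and "Y = q - b"
  note slope' = slope[folded X_def Y_def]
  have sl1: "(1 - 2 * r) * (2 * X + s) \<le> r * (2 * Y)"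
  proof -
    have "(1 - 2 * r) * (2 * X + s) \<le> 2 * ((1 - 2 * r) * (X + s))"
      using r s mult_nonneg_nonneg[of "1 - 2*r" s] by (simp add: algebra_simps)
    then show ?thesis using slope' by linarith
  qed
  have sl2: "(1 - 2 * r) * (2 * Y + s) \<le> 2 * X"
  proof -
    have "(1 - 2 * r) * (2 * Y + s) \<le> 2 * ((1 - 2 * r) * (Y + s))"
      using r s mult_nonneg_nonneg[of "1 - 2*r" s] by (simp add: algebra_simps)
    then show ?thesis using slope' by linarith
  qed
  have rs: "r * s \<ge> 0" "r * (r * s) \<ge> 0" "r * ((2 - r) * s) \<ge> 0" using r s by auto
  have 1: "F (p + (1 - r) * s) q \<le> F (p + r * s) (q + r * s)"
  proof -
    have "F (p + r * s) (q + r * s) - F (p + (1 - r) * s) q =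
        s * (r * (2 * Y) + r * (r * s) - (1 - 2 * r) * (2 * X + s))"
      unfolding F X_def Y_def by (simp add: power2_eq_square algebra_simps)
    also have "\<dots> \<ge> 0" using s sl1 rs by (intro mult_nonneg_nonneg) auto
    finally show ?thesis by simp
  qed
  have 2: "F p (q + (1 - r) * s) \<le> F (p + s) (q + r * s)"
  proof -
    have "F (p + s) (q + r * s) - F p (q + (1 - r) * s) = s * (2 * X + s - (1 - 2 * r) * (2 * Y + s))"
      unfolding F X_def Y_def by (simp add: power2_eq_square algebra_simps)
    also have "\<dots> \<ge> 0" using s sl2 by (intro mult_nonneg_nonneg) auto
    finally show ?thesis by simp
  qed
  have 3: "F (p + (1 - r) * s) (q + (1 - r) * s) \<le> F (p + r * s) (q + s)"
  proof -
    have "F (p + r * s) (q + s) - F (p + (1 - r) * s) (q + (1 - r) * s) =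
        s * (r * (2 * Y) + r * ((2 - r) * s) - (1 - 2 * r) * (2 * X + s))"
      unfolding F X_def Y_def by (simp add: power2_eq_square algebra_simps)
    also have "\<dots> \<ge> 0" using s sl1 rs by (intro mult_nonneg_nonneg) auto
    finally show ?thesis by simp
  qed
  have e: "p + (1 - r) * s + r * s = p + s" "q + (1 - r) * s + r * s = q + s"
    by (simp_all add: algebra_simps)
  consider "0 \<le> F (p + r * s) (q + r * s)"
    | "F (p + (1 - r) * s) q \<le> 0" "0 \<le> F (p + s) (q + r * s)"
    | "F p (q + (1 - r) * s) \<le> 0" "0 \<le> F (p + r * s) (q + s)"
    | "F (p + (1 - r) * s) (q + (1 - r) * s) \<le> 0"
    using 1 2 3 by linarith
  then show ?thesis
  proof cases
    case 1 then show ?thesis using sgn by (intro exI[of _ p] exI[of _ q]) auto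
  next
    case 2 then show ?thesis
      by (intro exI[of _ "p + (1 - r) * s"] exI[of _ q]) (auto simp: e)
  next
    case 3 then show ?thesis
      by (intro exI[of _ p] exI[of _ "q + (1 - r) * s"]) (auto simp: e)
  next
    case 4 then show ?thesis using sgn
      by (intro exI[of _ "p + (1 - r) * s"] exI[of _ "q + (1 - r) * s"]) (auto simp: e)
  qed
qed

text \<open>Iterated descent produces vertices in \<open>C\<close> at which \<open>F\<close> is arbitrarily small, and a continuous
  function attains its infimum on the compact set \<open>C\<close>.\<close>

lemma circle_meets_cantor_C:
  fixes r :: real
  assumes r: "0 < r" "r < 1/2"
    and X: "\<And>x y. x \<in> {0..r ^ N} \<Longrightarrow> y \<in> {0..r ^ N} \<Longrightarrow>
       (1 - 2 * r) * (x - a + r ^ N) \<le> r * (y - b) \<and> (1 - 2 * r) * (y - b + r ^ N) \<le> x - a"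
    and F: "\<And>x y. F x y = (x - a)\<^sup>2 + (y - b)\<^sup>2 - 1"
    and sgn: "F 0 0 \<le> 0" "0 \<le> F (r ^ N) (r ^ N)"
  shows "(a, b) \<in> cantor_A r"
proof -
  let ?K = "cantor_K r"
  \<comment> \<open>The first two conditions make the square one of the construction of \<open>C\<close>; the next four keep it
    in the initial square, where the slope is controlled.\<close>
  define inv where "inv = (\<lambda>n p q. (\<lambda>x. p + r ^ n * x) ` ?K \<subseteq> ?K \<and> (\<lambda>x. q + r ^ n * x) ` ?K \<subseteq> ?K
     \<and> 0 \<le> p \<and> p + r ^ n \<le> r ^ N \<and> 0 \<le> q \<and> q + r ^ n \<le> r ^ N \<and> F p q \<le> 0 \<and> 0 \<le> F (p + r ^ n) (q + r ^ n))"
  have chain: "\<exists>p q. inv (N + k) p q" for k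
  proof (induction k)
    case 0
    have "(\<lambda>x. r ^ n * x) ` ?K \<subseteq> ?K" for n
    proof (induction n)
      case (Suc n)
      then show ?case using cantor_K_child(1)[OF r] by (auto simp: mult.assoc)
    qed auto
    then have "inv (N + 0) 0 0" unfolding inv_def using sgn by simp
    then show ?case by blast
  next
    case (Suc k)
    then obtain p q where i: "inv (N + k) p q" by blast
    define s where "s = r ^ (N + k)"
    have s: "s > 0" "s \<le> r ^ N" using r by (auto simp: s_def power_add power_le_one mult_left_le)
    have i': "(\<lambda>x. p + s * x) ` ?K \<subseteq> ?K" "(\<lambda>x. q + s * x) ` ?K \<subseteq> ?K"
      "0 \<le> p" "p + s \<le> r ^ N" "0 \<le> q" "q + s \<le> r ^ N" "F p q \<le> 0" "0 \<le> F (p + s) (q + s)"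
      using i unfolding inv_def s_def by auto
    have sl: "(1 - 2 * r) * (p - a + r ^ N) \<le> r * (q - b)" "(1 - 2 * r) * (q - b + r ^ N) \<le> p - a"
      using X[of p q] i' s by auto
    have m: "(1 - 2 * r) * (z + s) \<le> (1 - 2 * r) * (z + r ^ N)" for z
      using r s by (intro mult_left_mono) auto
    have sl': "(1 - 2 * r) * (p - a + s) \<le> r * (q - b)" "(1 - 2 * r) * (q - b + s) \<le> p - a"
      using sl m[of "p - a"] m[of "q - b"] by linarith+
    obtain p' q' where c: "p' \<in> {p, p + (1 - r) * s}" "q' \<in> {q, q + (1 - r) * s}"
        "F p' q' \<le> 0" "0 \<le> F (p' + r * s) (q' + r * s)"
      using circle_descends[OF r s(1) sl' F i'(7,8)] by blast
    have child: "(\<lambda>x. z' + r * s * x) ` ?K \<subseteq> ?K"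
      if "(\<lambda>x. z + s * x) ` ?K \<subseteq> ?K" "z' \<in> {z, z + (1 - r) * s}" for z z'
    proof
      fix y assume "y \<in> (\<lambda>x. z' + r * s * x) ` ?K"
      then obtain x where x: "x \<in> ?K" "y = z' + r * s * x" by blast
      have "y = z + s * (r * x) \<or> y = z + s * (r * x + 1 - r)"
        using that(2) x(2) by (auto simp: algebra_simps)
      then show "y \<in> ?K" using that(1) cantor_K_child[OF r x(1)] by blast
    qed
    have rs: "0 \<le> (1 - r) * s" "r * s \<le> s" "(1 - r) * s + r * s = s"
      using r s by (auto simp: algebra_simps mult_left_le_one_le)
    have "inv (N + Suc k) p' q'"
      unfolding inv_def using child[OF i'(1) c(1)] child[OF i'(2) c(2)] c i' rs
      by (auto simp: s_def)
    then show ?case by blast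
  qed
  let ?f = "\<lambda>z. \<bar>F (fst z) (snd z)\<bar>"
  have comp: "compact (?K \<times> ?K)" using cantor_K(2)[OF r] by (simp add: compact_Times)
  have ne: "?K \<times> ?K \<noteq> {}" using cantor_K(1)[OF r] by simp
  have "continuous_on (?K \<times> ?K) ?f" unfolding F by (intro continuous_intros)
  from continuous_attains_inf[OF comp ne this]
  obtain z where z: "z \<in> ?K \<times> ?K" and le: "\<And>z'. z' \<in> ?K \<times> ?K \<Longrightarrow> ?f z \<le> ?f z'" by blast
  define M where "M = 2 * \<bar>a\<bar> + 2 * \<bar>b\<bar> + 6"
  have bound: "?f z \<le> r ^ (N + k) * M" for k
  proof -
    obtain p q where i: "inv (N + k) p q" using chain by blast
    define s where "s = r ^ (N + k)"
    have s: "s > 0" "s \<le> 1" using r by (auto simp: s_def power_le_one)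
    have i': "(\<lambda>x. p + s * x) ` ?K \<subseteq> ?K" "(\<lambda>x. q + s * x) ` ?K \<subseteq> ?K"
      "F p q \<le> 0" "0 \<le> F (p + s) (q + s)"
      using i unfolding inv_def s_def by auto
    have pq: "p \<in> ?K" "q \<in> ?K" using i'(1,2) zero_in_cantor_K[OF r] by force+
    then have "0 \<le> p" "p \<le> 1" "0 \<le> q" "q \<le> 1" using cantor_K_subset[OF r] by auto
    have "?f z \<le> \<bar>F p q\<bar>" using le[of "(p, q)"] pq by simp
    also have "\<dots> \<le> F (p + s) (q + s) - F p q" using i' by simp
    also have "\<dots> = s * (2 * (p - a) + 2 * (q - b) + 2 * s)"
      unfolding F by (simp add: power2_eq_square algebra_simps)
    also have "\<dots> \<le> s * M"
      using s \<open>p \<le> 1\<close> \<open>q \<le> 1\<close> by (intro mult_left_mono) (auto simp: M_def)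
    finally show ?thesis by (simp add: s_def)
  qed
  have "(\<lambda>k. r ^ (N + k) * M) \<longlonglongrightarrow> 0 * M"
    unfolding power_add using r by (intro tendsto_mult tendsto_const tendsto_mult_right_zero LIMSEQ_power_zero) auto
  then have "?f z \<le> 0" using bound by (intro LIMSEQ_le_const[of _ "0::real"]) auto
  then have "F (fst z) (snd z) = 0" by simp
  then have "(a - fst z, b - snd z) \<in> unit_circle"
    unfolding unit_circle_def F by (simp add: power2_commute)
  moreover have "z \<in> cantor_C r" using z by (simp add: cantor_C_def)
  ultimately have "z + (a - fst z, b - snd z) \<in> cantor_A r"
    unfolding cantor_A_def by (rule set_plus_intro[rotated])
  then show ?thesis by (simp add: plus_prod_def)
qed

lemma interior_cantor_A_nonempty:
  fixes r :: real
  assumes r: "1/4 < r" "r < 1/2"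
  shows "interior (cantor_A r) \<noteq> {}"
proof -
  have r0: "0 < r" using r by simp
  \<comment> \<open>A circle centred near \<open>(-u, -v)\<close> passes the origin with normal direction near \<open>(u, v)\<close>. The slope
    \<open>v / u = 2\<close> makes both conditions on the slope equivalent to \<open>r > 1/4\<close> in the limit of small squares.\<close>
  define u :: real where "u = 1 / sqrt 5"
  define v where "v = 2 * u"
  have u: "u > 0" by (simp add: u_def)
  have v: "v > 0" using u by (simp add: v_def)
  have uv: "u\<^sup>2 + v\<^sup>2 = 1" by (simp add: v_def u_def power_mult_distrib power_divide)
  have "1 * u < 4 * r * u" using u r by (intro mult_strict_right_mono) auto
  then have g1: "(1 - 2 * r) * u < r * v" and g2: "(1 - 2 * r) * v < u"
    by (simp_all add: v_def algebra_simps)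
  have lim: "(\<lambda>n. r ^ n) \<longlonglongrightarrow> 0" using r r0 by (intro LIMSEQ_power_zero) auto
  define e where "e = min (min ((r * v - (1 - 2 * r) * u) / 4) ((u - (1 - 2 * r) * v) / 4)) (u + v)"
  have "e > 0" using g1 g2 u v by (simp add: e_def)
  then obtain N where N: "r ^ N < e"
    using order_tendstoD(2)[OF lim] eventually_happens'[OF sequentially_bot] by blast
  define s where "s = r ^ N"
  have s: "s > 0" "4 * s < r * v - (1 - 2 * r) * u" "4 * s < u - (1 - 2 * r) * v" "s < u + v"
    using N r0 by (auto simp: s_def e_def)
  \<comment> \<open>The last two conditions put the vertices \<open>(0, 0)\<close> and \<open>(s, s)\<close> of the initial square inside and
    outside the unit circle around \<open>z\<close>.\<close>
  define U where "U = {z::real\<times>real. \<bar>fst z - (s / 2 - u)\<bar> < s / 2} \<inter> {z. \<bar>snd z - (s / 2 - v)\<bar> < s / 2}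
     \<inter> {z. (fst z)\<^sup>2 + (snd z)\<^sup>2 < 1} \<inter> {z. 1 < (s - fst z)\<^sup>2 + (s - snd z)\<^sup>2}"
  have "open U" unfolding U_def
    by (intro open_Int open_Collect_less continuous_intros)
  moreover have "(s / 2 - u, s / 2 - v) \<in> U"
  proof -
    have "s * (s / 2) < s * (u + v)" using s by (intro mult_strict_left_mono) auto
    moreover have "0 < s * (u + v)" using s u v by (intro mult_pos_pos) auto
    moreover have "(s / 2 - u)\<^sup>2 + (s / 2 - v)\<^sup>2 = 1 + s * (s / 2) - s * (u + v)"
        "(s - (s / 2 - u))\<^sup>2 + (s - (s / 2 - v))\<^sup>2 = 1 + s * (s / 2) + s * (u + v)"
      using uv by (simp_all add: power2_eq_square algebra_simps)
    moreover have "0 < s * (s / 2) + s * (u + v)" using s u v by (intro add_pos_pos mult_pos_pos) auto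
    ultimately show ?thesis using s unfolding U_def by simp
  qed
  moreover have "U \<subseteq> cantor_A r"
  proof
    fix z assume z: "z \<in> U"
    obtain a b where ab: "z = (a, b)" by (cases z)
    have d: "\<bar>a - (s / 2 - u)\<bar> < s / 2" "\<bar>b - (s / 2 - v)\<bar> < s / 2" "a\<^sup>2 + b\<^sup>2 < 1" "1 < (s - a)\<^sup>2 + (s - b)\<^sup>2"
      using z unfolding U_def ab by auto
    have "(a, b) \<in> cantor_A r"
    proof (rule circle_meets_cantor_C[OF r0 r(2), of N a b "\<lambda>x y. (x - a)\<^sup>2 + (y - b)\<^sup>2 - 1"], goal_cases)
      case (1 x y)
      then have xy: "0 \<le> x" "x \<le> s" "0 \<le> y" "y \<le> s" by (auto simp: s_def)
      have b: "x - a \<le> u + s" "u - s \<le> x - a" "y - b \<le> v + s" "v - s \<le> y - b"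
        using d(1,2) xy by linarith+
      have "(1 - 2 * r) * (x - a + s) \<le> (1 - 2 * r) * (u + 2 * s)"
        using b r by (intro mult_left_mono) auto
      also have "\<dots> \<le> (1 - 2 * r) * u + 2 * s" using r s by (simp add: algebra_simps)
      also have "\<dots> \<le> r * v - s" using s by linarith
      also have "\<dots> \<le> r * (v - s)" using r s by (simp add: algebra_simps mult_left_le_one_le)
      also have "\<dots> \<le> r * (y - b)" using b r0 by (intro mult_left_mono) auto
      finally have A: "(1 - 2 * r) * (x - a + s) \<le> r * (y - b)" .
      have "(1 - 2 * r) * (y - b + s) \<le> (1 - 2 * r) * (v + 2 * s)"
        using b r by (intro mult_left_mono) auto
      also have "\<dots> \<le> (1 - 2 * r) * v + 2 * s" using r s by (simp add: algebra_simps)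
      also have "\<dots> \<le> u - s" using s by linarith
      also have "\<dots> \<le> x - a" using b by simp
      finally show ?case using A by (simp add: s_def)
    qed (use d in \<open>auto simp: s_def\<close>)
    then show "z \<in> cantor_A r" by (simp add: ab)
  qed
  ultimately show ?thesis using interior_maximal by blast
qed

section \<open>Shadows of the Cantor square\<close>

text \<open>Up to scaling, the orthogonal projection of \<open>C\<close> to the line spanned by \<open>(1, t)\<close>.\<close>

definition shadow :: "real \<Rightarrow> real \<Rightarrow> real set" where
  "shadow r t = {x + t * y | x y. x \<in> cantor_K r \<and> y \<in> cantor_K r}"

lemma compact_shadow:
  assumes r: "0 < r" "r < 1/2"
  shows "compact (shadow r t)"
proof -
  have "shadow r t = (\<lambda>z. fst z + t * snd z) ` (cantor_K r \<times> cantor_K r)"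
    by (force simp: shadow_def)
  then show ?thesis
    using cantor_K(2)[OF r] by (auto intro!: compact_continuous_image continuous_intros compact_Times)
qed

lemma shadow_lmeasurable: "0 < r \<Longrightarrow> r < 1/2 \<Longrightarrow> shadow r t \<in> lmeasurable"
  by (intro lmeasurable_compact compact_shadow)

lemma shadow_cylinders:
  assumes r: "0 < r" "r < 1/2"
  shows "shadow r t = (\<Union>z\<in>corners r n \<times> corners r n. (\<lambda>x. (fst z + t * snd z) + r ^ n * x) ` shadow r t)"
    (is "_ = ?R")
proof
  show "shadow r t \<subseteq> ?R"
  proof
    fix w assume "w \<in> shadow r t"
    then obtain x y where w: "x \<in> cantor_K r" "y \<in> cantor_K r" "w = x + t * y"
      by (auto simp: shadow_def)
    obtain p x' where x: "p \<in> corners r n" "x' \<in> cantor_K r" "x = p + r ^ n * x'"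
      using w(1) cantor_K_cylinders[OF r, of n] by blast
    obtain q y' where y: "q \<in> corners r n" "y' \<in> cantor_K r" "y = q + r ^ n * y'"
      using w(2) cantor_K_cylinders[OF r, of n] by blast
    have "w = (p + t * q) + r ^ n * (x' + t * y')" unfolding w x y by (simp add: algebra_simps)
    moreover have "x' + t * y' \<in> shadow r t" using x y by (auto simp: shadow_def)
    ultimately show "w \<in> ?R" using x(1) y(1) by force
  qed
  show "?R \<subseteq> shadow r t"
  proof
    fix w assume "w \<in> ?R"
    then obtain p q x y where *: "p \<in> corners r n" "q \<in> corners r n" "x \<in> cantor_K r" "y \<in> cantor_K r"
      "w = (p + t * q) + r ^ n * (x + t * y)"
      by (auto simp: shadow_def)
    have "p + r ^ n * x \<in> cantor_K r" "q + r ^ n * y \<in> cantor_K r"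
      using * cantor_K_cylinders[OF r, of n] by blast+
    moreover have "w = (p + r ^ n * x) + t * (q + r ^ n * y)"
      unfolding * by (simp add: algebra_simps)
    ultimately show "w \<in> shadow r t" by (auto simp: shadow_def)
  qed
qed

lemma measure_affine_image:
  fixes S :: "real set"
  shows "measure lebesgue ((\<lambda>x. c + m * x) ` S) = \<bar>m\<bar> * measure lebesgue S"
  using measure_lebesgue_affine[of m c S] by (simp add: add.commute)

lemma lmeasurable_affine_compact:
  fixes S :: "real set"
  assumes "compact S"
  shows "(\<lambda>x. c + m * x) ` S \<in> lmeasurable"
  by (intro lmeasurable_compact compact_continuous_image continuous_intros assms)

lemma measure_shadow_cylinders_le:
  fixes r :: real
  assumes r: "0 < r" "r < 1/2" and Z: "finite Z"
  shows "measure lebesgue (\<Union>z\<in>Z. (\<lambda>x. (fst z + t * snd z) + r ^ n * x) ` shadow r t)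
     \<le> real (card Z) * r ^ n * measure lebesgue (shadow r t)"
proof -
  have "measure lebesgue (\<Union>z\<in>Z. (\<lambda>x. (fst z + t * snd z) + r ^ n * x) ` shadow r t)
     \<le> (\<Sum>z\<in>Z. measure lebesgue ((\<lambda>x. (fst z + t * snd z) + r ^ n * x) ` shadow r t))"
    using Z lmeasurable_affine_compact[OF compact_shadow[OF r]]
    by (intro measure_UNION_le) (auto intro: fmeasurableD)
  also have "\<dots> = real (card Z) * r ^ n * measure lebesgue (shadow r t)"
    unfolding measure_affine_image using r by (simp add: abs_of_pos)
  finally show ?thesis .
qed

lemma shadow_null_small_ratio:
  assumes r: "0 < r" "r < 1/4"
  shows "measure lebesgue (shadow r t) = 0"
proof -
  have r': "r < 1/2" using r by simp
  let ?\<mu> = "measure lebesgue (shadow r t)" and ?Z = "corners r 1 \<times> corners r 1"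
  have "?\<mu> \<le> real (card ?Z) * r ^ 1 * ?\<mu>"
    using measure_shadow_cylinders_le[OF r(1) r', of ?Z t 1] shadow_cylinders[OF r(1) r', of t 1] by simp
  also have "\<dots> \<le> 4 * r ^ 1 * ?\<mu>"
  proof -
    have "card ?Z \<le> 2 * 2"
      using card_corners_le[of r 1] unfolding card_cartesian_product by (intro mult_mono) auto
    then have "real (card ?Z) \<le> 4" by linarith
    then show ?thesis using r by (intro mult_right_mono) auto
  qed
  finally have "(1 - 4 * r) * ?\<mu> \<le> 0" by (simp add: algebra_simps)
  then have "?\<mu> \<le> 0" using r by (simp add: mult_le_0_iff)
  then show ?thesis using measure_nonneg[of lebesgue "shadow r t"] by linarith
qed

text \<open>A compact set has open neighbourhoods of almost the same measure, and these contain all small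
  translates.\<close>

lemma measure_Un_translate_lt:
  fixes T :: "real set"
  assumes T: "compact T" "measure lebesgue T > 0"
  obtains e where "e > 0" "\<And>d. \<bar>d\<bar> < e \<Longrightarrow> measure lebesgue (T \<union> (+) d ` T) < 2 * measure lebesgue T"
proof -
  let ?\<mu> = "measure lebesgue T"
  have TL: "T \<in> lmeasurable" using T by (intro lmeasurable_compact)
  obtain U where U: "open U" "T \<subseteq> U" "U - T \<in> lmeasurable" "emeasure lebesgue (U - T) < ennreal ?\<mu>"
    using sets_lebesgue_outer_open[of T ?\<mu>] TL T by (auto intro: fmeasurableD)
  have small: "measure lebesgue (U - T) < ?\<mu>"
    using U(3,4) by (simp add: emeasure_eq_measure2 ennreal_less_iff)
  obtain e where e: "e > 0" "(\<Union>x\<in>T. ball x e) \<subseteq> U"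
    using compact_subset_open_imp_ball_epsilon_subset[OF T(1) U(1,2)] by blast
  have "measure lebesgue (T \<union> (+) d ` T) < 2 * ?\<mu>" if "\<bar>d\<bar> < e" for d
  proof -
    have "x + d \<in> U" if "x \<in> T" for x
      using e that \<open>\<bar>d\<bar> < e\<close> by (force simp: dist_real_def)
    then have sub: "T \<union> (+) d ` T \<subseteq> T \<union> (U - T)" using U(2) by (auto simp: add.commute)
    have "compact (T \<union> (+) d ` T)"
      by (intro compact_Un compact_continuous_image continuous_intros T)
    then have "T \<union> (+) d ` T \<in> sets lebesgue" by (intro fmeasurableD lmeasurable_compact)
    then have "measure lebesgue (T \<union> (+) d ` T) \<le> measure lebesgue (T \<union> (U - T))"
      using sub fmeasurable.Un[OF TL U(3)] by (intro measure_mono_fmeasurable)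
    also have "\<dots> \<le> measure lebesgue T + measure lebesgue (U - T)"
      using TL U(3) by (intro measure_Un_le) auto
    finally show ?thesis using small by simp
  qed
  then show ?thesis using e(1) that by blast
qed

text \<open>The \<open>4\<^sup>n\<close> cylinders of a shadow have total measure equal to that of the shadow, so they cannot
  overlap in positive measure. Two of them, enlarged by \<open>4\<^sup>n\<close>, are the shadow and its translate by \<open>d\<close>.\<close>

lemma shadow_double:
  assumes z: "z1 \<in> corners (1/4) n \<times> corners (1/4) n" "z2 \<in> corners (1/4) n \<times> corners (1/4) n" "z1 \<noteq> z2"
    and d: "d = 4 ^ n * ((fst z2 + t * snd z2) - (fst z1 + t * snd z1))"
  shows "2 * measure lebesgue (shadow (1/4) t) \<le> measure lebesgue (shadow (1/4) t \<union> (+) d ` shadow (1/4) t)"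
proof -
  let ?T = "shadow (1/4) t" and ?Z = "corners (1/4) n \<times> corners (1/4) n"
  let ?P = "\<lambda>z. (\<lambda>x. (fst z + t * snd z) + (1/4) ^ n * x) ` ?T"
  let ?\<mu> = "measure lebesgue ?T" and ?\<nu> = "measure lebesgue (?T \<union> (+) d ` ?T)"
  let ?R = "?Z - {z1, z2}"
  have q: "(0::real) < 1/4" "(1/4::real) < 1/2" by auto
  have T: "compact ?T" by (rule compact_shadow[OF q])
  have "compact (?T \<union> (+) d ` ?T)"
    by (intro compact_Un compact_continuous_image continuous_intros T)
  note c = lmeasurable_affine_compact[OF this]
  have P: "?P z \<in> lmeasurable" for z by (rule lmeasurable_affine_compact[OF T])
  have two: "?P z1 \<union> ?P z2 = (\<lambda>x. (fst z1 + t * snd z1) + (1/4) ^ n * x) ` (?T \<union> (+) d ` ?T)"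
  proof -
    have "(1/4) ^ n * (4::real) ^ n = 1" by (simp flip: power_mult_distrib)
    then have "(fst z2 + t * snd z2) + (1/4) ^ n * x = (fst z1 + t * snd z1) + (1/4) ^ n * (d + x)" for x
      unfolding d by (simp add: algebra_simps)
    then show ?thesis unfolding image_Un image_image by simp
  qed
  have card: "real (card ?R) \<le> 4 ^ n - 2"
  proof -
    have "card ?Z \<le> 2 ^ n * 2 ^ n"
      unfolding card_cartesian_product using card_corners_le by (intro mult_mono) auto
    also have "\<dots> = (4::nat) ^ n" by (simp flip: power_mult_distrib)
    finally have le: "card ?Z \<le> 4 ^ n" .
    have "card ?R = card ?Z - card {z1, z2}" using z by (intro card_Diff_subset) auto
    moreover have "card {z1, z2} = 2" using z by simp
    moreover have "2 \<le> card ?Z"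
      using card_mono[of ?Z "{z1, z2}"] z by simp
    ultimately have "card ?R + 2 \<le> 4 ^ n" using le by linarith
    then have "real (card ?R + 2) \<le> real (4 ^ n)" by (simp only: of_nat_le_iff)
    then show ?thesis by simp
  qed
  have split: "(\<Union>z\<in>Z. P z) = (P z1 \<union> P z2) \<union> (\<Union>z\<in>Z - {z1, z2}. P z)"
    if "z1 \<in> Z" "z2 \<in> Z" for Z and P :: "real \<times> real \<Rightarrow> real set"
    using that by auto
  have "?T = (?P z1 \<union> ?P z2) \<union> (\<Union>z\<in>?R. ?P z)"
    using shadow_cylinders[OF q, of t n] unfolding split[OF z(1,2)] .
  moreover have "measure lebesgue ((?P z1 \<union> ?P z2) \<union> (\<Union>z\<in>?R. ?P z))
      \<le> measure lebesgue (?P z1 \<union> ?P z2) + measure lebesgue (\<Union>z\<in>?R. ?P z)"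
    using P by (intro measure_Un_le sets.Un sets.finite_UN fmeasurableD) auto
  ultimately have "?\<mu> \<le> measure lebesgue (?P z1 \<union> ?P z2) + measure lebesgue (\<Union>z\<in>?R. ?P z)" by simp
  also have "measure lebesgue (?P z1 \<union> ?P z2) = (1/4) ^ n * ?\<nu>"
    unfolding two measure_affine_image by simp
  also have "measure lebesgue (\<Union>z\<in>?R. ?P z) \<le> real (card ?R) * (1/4) ^ n * ?\<mu>"
    by (rule measure_shadow_cylinders_le[OF q]) simp
  also have "\<dots> \<le> (4 ^ n - 2) * (1/4) ^ n * ?\<mu>"
    using card by (intro mult_right_mono) auto
  finally have "4 ^ n * ?\<mu> \<le> 4 ^ n * ((1/4) ^ n * ?\<nu> + (4 ^ n - 2) * (1/4) ^ n * ?\<mu>)" by simp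
  also have "\<dots> = (4 ^ n * (1/4) ^ n) * ?\<nu> + (4 ^ n - 2) * (4 ^ n * (1/4) ^ n) * ?\<mu>"
    by (simp only: algebra_simps)
  also have "(4::real) ^ n * (1/4) ^ n = 1" by (simp flip: power_mult_distrib)
  finally show ?thesis by (simp add: algebra_simps)
qed


section \<open>Almost every shadow of the four corner set is null\<close>

text \<open>Integers with \<open>n\<close> base 4 digits from \<open>{-1, 0, 1}\<close>: the differences of corners of level \<open>n\<close>,
  in units of their smallest weight.\<close>

primrec digit_diffs :: "nat \<Rightarrow> real set" where
  "digit_diffs 0 = {0}"
| "digit_diffs (Suc n) = {4 * a + i | a i. a \<in> digit_diffs n \<and> i \<in> {-1, 0, 1}}"

lemma digit_diffs_Suc_I: "a \<in> digit_diffs n \<Longrightarrow> i \<in> {-1, 0, 1} \<Longrightarrow> 4 * a + i \<in> digit_diffs (Suc n)"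
  by auto

lemma digit_diffs_corners:
  "a \<in> digit_diffs n \<Longrightarrow> \<exists>p\<in>corners (1/4) n. \<exists>p'\<in>corners (1/4) n. 4 ^ n * (p' - p) = 3 * a"
proof (induction n arbitrary: a)
  case (Suc n)
  then obtain b i where b: "b \<in> digit_diffs n" "i \<in> {-1, 0, 1}" "a = 4 * b + i" by auto
  then obtain p p' where p: "p \<in> corners (1/4) n" "p' \<in> corners (1/4) n" "4 ^ n * (p' - p) = 3 * b"
    using Suc.IH by blast
  let ?s = "(1/4::real) ^ n * (1 - 1/4)"
  have s: "4 ^ n * ?s = 3/4" by (simp flip: power_mult_distrib mult.assoc)
  have mem: "p \<in> corners (1/4) (Suc n)" "p' \<in> corners (1/4) (Suc n)"
    "p + ?s \<in> corners (1/4) (Suc n)" "p' + ?s \<in> corners (1/4) (Suc n)"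
    using p by auto
  have "4 ^ Suc n * ((p' + ?s) - p) = 4 * (4 ^ n * (p' - p)) + 4 * (4 ^ n * ?s)"
    "4 ^ Suc n * (p' - (p + ?s)) = 4 * (4 ^ n * (p' - p)) - 4 * (4 ^ n * ?s)"
    "4 ^ Suc n * (p' - p) = 4 * (4 ^ n * (p' - p))"
    by (simp_all only: power_Suc algebra_simps)
  then have v: "4 ^ Suc n * ((p' + ?s) - p) = 3 * (4 * b + 1)"
    "4 ^ Suc n * (p' - (p + ?s)) = 3 * (4 * b - 1)" "4 ^ Suc n * (p' - p) = 3 * (4 * b)"
    unfolding s p(3) by auto
  consider "i = 1" | "i = -1" | "i = 0" using b(2) by blast
  then show ?case
  proof cases
    case 1
    show ?thesis by (rule bexI[OF _ mem(1)], rule bexI[OF _ mem(4)]) (simp only: v 1 b)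
  next
    case 2
    show ?thesis by (rule bexI[OF _ mem(3)], rule bexI[OF _ mem(2)]) (simp only: v 2 b, simp)
  next
    case 3
    show ?thesis by (rule bexI[OF _ mem(1)], rule bexI[OF _ mem(2)]) (simp only: v 3 b, simp)
  qed
qed simp

text \<open>A small value of \<open>a + t b\<close> exhibits two cylinders that coincide up to a tiny translation, hence
  overlap.\<close>

lemma shadow_null_of_small_differences:
  assumes small: "\<And>e. e > 0 \<Longrightarrow> \<exists>n. \<exists>a\<in>digit_diffs n. \<exists>b\<in>digit_diffs n. (a, b) \<noteq> (0, 0) \<and> \<bar>a + t * b\<bar> < e"
  shows "measure lebesgue (shadow (1/4) t) = 0"
proof (rule ccontr)
  assume "measure lebesgue (shadow (1/4) t) \<noteq> 0"
  then have pos: "measure lebesgue (shadow (1/4) t) > 0"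
    using measure_nonneg[of lebesgue "shadow (1/4) t"] by linarith
  have "compact (shadow (1/4) t)" by (rule compact_shadow) auto
  from measure_Un_translate_lt[OF this pos]
  obtain e where e: "e > 0" "\<And>d. \<bar>d\<bar> < e \<Longrightarrow> measure lebesgue (shadow (1/4) t \<union> (+) d ` shadow (1/4) t)
     < 2 * measure lebesgue (shadow (1/4) t)" by blast
  obtain n a b where ab: "a \<in> digit_diffs n" "b \<in> digit_diffs n" "(a, b) \<noteq> (0, 0)" "\<bar>a + t * b\<bar> < e / 3"
    using small[of "e / 3"] e(1) by auto
  obtain p p' where p: "p \<in> corners (1/4) n" "p' \<in> corners (1/4) n" "4 ^ n * (p' - p) = 3 * a"
    using digit_diffs_corners[OF ab(1)] by blast
  obtain q q' where q: "q \<in> corners (1/4) n" "q' \<in> corners (1/4) n" "4 ^ n * (q' - q) = 3 * b"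
    using digit_diffs_corners[OF ab(2)] by blast
  define d where "d = 4 ^ n * ((p' + t * q') - (p + t * q))"
  have "d = 4 ^ n * (p' - p) + t * (4 ^ n * (q' - q))" by (simp add: d_def algebra_simps)
  then have "d = 3 * (a + t * b)" unfolding p q by (simp add: algebra_simps)
  then have "\<bar>d\<bar> = 3 * \<bar>a + t * b\<bar>" by (simp only: abs_mult abs_numeral)
  then have "\<bar>d\<bar> < e" using ab(4) by argo
  moreover have "(p, q) \<noteq> (p', q')" using p q ab(3) by auto
  then have "2 * measure lebesgue (shadow (1/4) t) \<le> measure lebesgue (shadow (1/4) t \<union> (+) d ` shadow (1/4) t)"
    using p q by (intro shadow_double[of "(p, q)" n "(p', q')"]) (auto simp: d_def)
  ultimately show False using e(2)[of d] by linarith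
qed

text \<open>Every interval loses a fixed proportion \<open>k\<close> of its length to a hole. Applied again to the two
  remaining intervals, this bounds the measure by \<open>(1 - k)\<^sup>n\<close> times the length for every \<open>n\<close>.\<close>

lemma porous_negligible:
  fixes B :: "real set"
  assumes B: "closed B" "B \<subseteq> {u..v}" and k: "0 < k" "k \<le> 1"
    and hole: "\<And>c d. u \<le> c \<Longrightarrow> c < d \<Longrightarrow> d \<le> v \<Longrightarrow>
       \<exists>h \<rho>. c \<le> h - \<rho> \<and> h + \<rho> \<le> d \<and> k * (d - c) \<le> 2 * \<rho> \<and> B \<inter> {h - \<rho><..<h + \<rho>} = {}"
  shows "negligible B"
proof (cases "u \<le> v")
  case True
  have lm: "B \<inter> {c..d} \<in> lmeasurable" for c d
    using B(1) by (intro lmeasurable_compact closed_Int_compact) auto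
  have bound: "measure lebesgue (B \<inter> {c..d}) \<le> (1 - k) ^ n * (d - c)"
    if "u \<le> c" "c \<le> d" "d \<le> v" for n c d
    using that
  proof (induction n arbitrary: c d)
    case 0
    have "measure lebesgue (B \<inter> {c..d}) \<le> measure lebesgue {c..d}"
      using lm by (intro measure_mono_fmeasurable) (auto dest: fmeasurableD)
    then show ?case using 0 by simp
  next
    case (Suc n)
    show ?case
    proof (cases "c = d")
      case True
      have "measure lebesgue (B \<inter> {c..d}) \<le> measure lebesgue {c..d}"
        using lm by (intro measure_mono_fmeasurable) (auto dest: fmeasurableD)
      then show ?thesis using True by simp
    next
      case False
      then obtain h \<rho> where h: "c \<le> h - \<rho>" "h + \<rho> \<le> d" "k * (d - c) \<le> 2 * \<rho>" "B \<inter> {h - \<rho><..<h + \<rho>} = {}"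
        using hole[of c d] Suc.prems by auto
      have "0 \<le> k * (d - c)" using k Suc.prems by simp
      then have \<rho>: "\<rho> \<ge> 0" using h(3) by linarith
      have "B \<inter> {c..d} \<subseteq> (B \<inter> {c..h - \<rho>}) \<union> (B \<inter> {h + \<rho>..d})"
        using h(4) by fastforce
      then have "measure lebesgue (B \<inter> {c..d}) \<le> measure lebesgue ((B \<inter> {c..h - \<rho>}) \<union> (B \<inter> {h + \<rho>..d}))"
        using lm by (intro measure_mono_fmeasurable) (auto dest: fmeasurableD)
      also have "\<dots> \<le> measure lebesgue (B \<inter> {c..h - \<rho>}) + measure lebesgue (B \<inter> {h + \<rho>..d})"
        using lm by (intro measure_Un_le) (auto dest: fmeasurableD)
      also have "\<dots> \<le> (1 - k) ^ n * (h - \<rho> - c) + (1 - k) ^ n * (d - (h + \<rho>))"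
        using h \<rho> Suc.prems by (intro add_mono Suc.IH) auto
      also have "\<dots> = (1 - k) ^ n * (d - c - 2 * \<rho>)" by (simp add: algebra_simps)
      also have "\<dots> \<le> (1 - k) ^ n * ((1 - k) * (d - c))"
        using k h(3) by (intro mult_left_mono) (auto simp: algebra_simps)
      finally show ?thesis by (simp add: algebra_simps)
    qed
  qed
  have "(\<lambda>n. (1 - k) ^ n * (v - u)) \<longlonglongrightarrow> 0 * (v - u)"
    using k by (intro tendsto_mult tendsto_const LIMSEQ_power_zero) auto
  then have "measure lebesgue (B \<inter> {u..v}) \<le> 0"
    using bound[of u v] True by (intro LIMSEQ_le_const) auto
  then have "measure lebesgue (B \<inter> {u..v}) = 0"
    using measure_nonneg[of lebesgue "B \<inter> {u..v}"] by linarith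
  then show ?thesis using lm[of u v] B(2) negligible_iff_measure by (metis inf.orderE)
qed (use B in auto)

text \<open>A greedy choice of digits. With \<open>h = (1 + t) / 3\<close> and \<open>x = a + t b\<close> in \<open>[-h, h]\<close>, appending digits
  \<open>i\<close> and \<open>j\<close> replaces \<open>x\<close> by \<open>4 x + (i + t j)\<close>. The points \<open>0\<close>, \<open>1\<close>, \<open>t\<close>, \<open>1 + t\<close> and their negatives
  are at most \<open>2 h\<close> apart for \<open>1/2 \<le> t \<le> 2\<close> and reach to distance \<open>h\<close> from \<open>\<plusminus>4 h\<close>, so some choice returns to
  \<open>[-h, h]\<close>. Starting from \<open>b = 1\<close>, the size of \<open>b\<close> is comparable to \<open>4\<^sup>n\<close>, which provides a ratio
  \<open>-a/b\<close> near \<open>t\<close> at each scale.\<close>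

lemma bounded_difference:
  fixes t :: real
  assumes t: "1/2 \<le> t" "t \<le> 2"
  shows "\<exists>a\<in>digit_diffs (Suc n). \<exists>b\<in>digit_diffs (Suc n). 2 * 4 ^ n + 1 \<le> 3 * b \<and> 3 * b \<le> 4 * 4 ^ n - 1 \<and>
     \<bar>a + t * b\<bar> \<le> (1 + t) / 3"
proof (induction n)
  case 0
  have "-1 \<in> digit_diffs (Suc 0)" "1 \<in> digit_diffs (Suc 0)" by auto
  moreover have "2 * 4 ^ 0 + 1 \<le> 3 * (1::real) \<and> 3 * (1::real) \<le> 4 * 4 ^ 0 - 1 \<and>
      \<bar>- 1 + t * 1\<bar> \<le> (1 + t) / 3" using t by (auto simp: abs_if)
  ultimately show ?case by blast
next
  case (Suc n)
  then obtain a b where ab: "a \<in> digit_diffs (Suc n)" "b \<in> digit_diffs (Suc n)" "2 * 4 ^ n + 1 \<le> 3 * b"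
    "3 * b \<le> 4 * 4 ^ n - 1" "\<bar>a + t * b\<bar> \<le> (1 + t) / 3" by blast
  define x where "x = a + t * b"
  have x: "\<bar>x\<bar> \<le> (1 + t) / 3" using ab by (simp add: x_def)
  define h where "h = (1 + t) / 3"
  have "\<exists>i\<in>{-1, 0, 1}. \<exists>j\<in>{-1, 0, 1}. \<bar>4 * x + (i + t * j)\<bar> \<le> h"
  proof -
    have h: "3 * h = 1 + t" "\<bar>x\<bar> \<le> h" using x by (simp_all add: h_def)
    have near: "\<bar>y\<bar> \<le> h \<or> \<bar>y - 1\<bar> \<le> h \<or> \<bar>y - t\<bar> \<le> h \<or> \<bar>y - (1 + t)\<bar> \<le> h"
      if "0 \<le> y" "y \<le> 4 * h" for y
      unfolding abs_le_iff using that h(1) t by linarith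
    have "\<bar>4 * x\<bar> \<le> h \<or> \<bar>4 * x + 1\<bar> \<le> h \<or> \<bar>4 * x - 1\<bar> \<le> h \<or> \<bar>4 * x + t\<bar> \<le> h \<or>
      \<bar>4 * x - t\<bar> \<le> h \<or> \<bar>4 * x + (1 + t)\<bar> \<le> h \<or> \<bar>4 * x - (1 + t)\<bar> \<le> h"
    proof (cases "0 \<le> x")
      case True
      then show ?thesis using near[of "4 * x"] h(2) by auto
    next
      case False
      have "\<bar>- (4 * x) - c\<bar> = \<bar>4 * x + c\<bar>" for c by (simp add: abs_if)
      then show ?thesis using False near[of "- (4 * x)"] h(2) by auto
    qed
    then show ?thesis by auto
  qed
  then obtain i j where ij: "i \<in> {-1, 0, 1}" "j \<in> {-1, 0, 1}" "\<bar>4 * x + (i + t * j)\<bar> \<le> (1 + t) / 3"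
    unfolding h_def by blast
  have "4 * x + (i + t * j) = (4 * a + i) + t * (4 * b + j)" by (simp add: x_def algebra_simps)
  then have "\<bar>(4 * a + i) + t * (4 * b + j)\<bar> \<le> (1 + t) / 3" using ij(3) by (simp only:)
  moreover have "2 * 4 ^ Suc n + 1 \<le> 3 * (4 * b + j)" "3 * (4 * b + j) \<le> 4 * 4 ^ Suc n - 1"
    using ab(3,4) ij(2) by auto
  ultimately show ?case
    using digit_diffs_Suc_I[OF ab(1) ij(1)] digit_diffs_Suc_I[OF ab(2) ij(2)] by blast
qed

text \<open>The directions without near coincidences of precision \<open>e\<close>.\<close>

definition separated :: "real \<Rightarrow> real set" where
  "separated e = {t \<in> {1/2..2}. \<forall>n. \<forall>a\<in>digit_diffs n. \<forall>b\<in>digit_diffs n. (a, b) \<noteq> (0, 0) \<longrightarrow> e \<le> \<bar>a + t * b\<bar>}"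

text \<open>If \<open>\<bar>a + t b\<bar>\<close> is at most 1 at the midpoint \<open>t\<close> of an interval, then \<open>-a/b\<close> is within \<open>1/b\<close> of \<open>t\<close>, and
  the points within \<open>e/b\<close> of \<open>-a/b\<close> are not separated. This is a hole of the right proportion once
  \<open>b\<close> is comparable to the reciprocal of the length of the interval.\<close>

lemma separated_negligible:
  assumes e: "0 < e" "e \<le> 1"
  shows "negligible (separated e)"
proof (rule porous_negligible[of _ "1/2" 2 "e / 16"])
  have "separated e = {1/2..2} \<inter> (\<Inter>n. \<Inter>a\<in>digit_diffs n. \<Inter>b\<in>digit_diffs n. {t. (a, b) \<noteq> (0, 0) \<longrightarrow> e \<le> \<bar>a + t * b\<bar>})"
    by (auto simp: separated_def)
  also have "closed \<dots>"
    by (intro closed_Int closed_INT ballI closed_Collect_imp closed_Collect_le continuous_intros) auto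
  finally show "closed (separated e)" .
  fix c d :: real assume cd: "1/2 \<le> c" "c < d" "d \<le> 2"
  define t where "t = (c + d) / 2"
  have t: "1/2 \<le> t" "t \<le> 2" using cd by (auto simp: t_def)
  \<comment> \<open>Below, \<open>b\<close> lies between \<open>2/3\<close> and \<open>4/3\<close> of \<open>4\<^sup>n\<close>. The first bound on \<open>n\<close> then keeps the hole inside
    the interval, and the second one keeps the hole long.\<close>
  obtain n where n: "(1/4::real) ^ n \<le> (d - c) / 6" "(d - c) / 6 < 4 * (1/4) ^ n"
  proof -
    define P where "P n \<longleftrightarrow> (1/4::real) ^ n \<le> (d - c) / 6" for n
    obtain N where "(1/4::real) ^ N < (d - c) / 6"
      using real_arch_pow_inv[of "(d - c) / 6" "1/4"] cd by auto
    then have "P N" by (simp add: P_def)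
    then have least: "P (LEAST n. P n)" by (rule LeastI)
    moreover have "(LEAST n. P n) \<noteq> 0"
    proof
      assume "(LEAST n. P n) = 0"
      then have "P 0" using least by simp
      then show False using cd by (simp add: P_def)
    qed
    then obtain m where m: "(LEAST n. P n) = Suc m" by (metis not0_implies_Suc)
    then have "\<not> P m" using not_less_Least[of m P] by simp
    moreover have "P (Suc m)" using least m by simp
    ultimately show ?thesis using that[of "Suc m"] by (simp add: P_def)
  qed
  obtain a b where ab: "a \<in> digit_diffs (Suc n)" "b \<in> digit_diffs (Suc n)" "2 * 4 ^ n + 1 \<le> 3 * b"
    "3 * b \<le> 4 * 4 ^ n - 1" "\<bar>a + t * b\<bar> \<le> (1 + t) / 3" using bounded_difference[OF t] by blast
  have n4: "(4::real) ^ n > 0" "(1/4::real) ^ n = 1 / 4 ^ n" by (auto simp: power_divide)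
  have b: "b > 0" using ab(3) n4(1) by linarith
  have inv_b: "1 / b \<le> 3/2 * (1/4) ^ n" "3/4 * (1/4) ^ n \<le> 1 / b"
    unfolding n4(2) using ab(3,4) b n4(1) by (auto simp: field_simps)
  define h \<rho> where "h = - a / b" and "\<rho> = e / b"
  have \<rho>: "\<rho> \<le> 1 / b" "3/4 * (1/4) ^ n * e \<le> \<rho>"
  proof -
    show "\<rho> \<le> 1 / b" using e b by (simp add: \<rho>_def divide_right_mono)
    have "3/4 * (1/4) ^ n * e \<le> 1 / b * e" using inv_b e by (intro mult_right_mono) auto
    then show "3/4 * (1/4) ^ n * e \<le> \<rho>" by (simp add: \<rho>_def)
  qed
  have "\<bar>t - h\<bar> = \<bar>a + t * b\<bar> / b" using b by (simp add: h_def field_simps abs_if)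
  also have "\<dots> \<le> 1 / b" using ab(5) t b by (intro divide_right_mono) auto
  finally have th: "\<bar>t - h\<bar> \<le> 1 / b" .
  have quarter: "1 / b \<le> (d - c) / 4" using inv_b(1) n(1) by argo
  have "h \<le> t + 1 / b" "t \<le> h + 1 / b" using th by argo+
  then have "c \<le> h - \<rho>" "h + \<rho> \<le> d" using \<rho>(1) quarter unfolding t_def by argo+
  moreover have "e / 16 * (d - c) \<le> 2 * \<rho>"
  proof -
    have "(d - c) / 24 * e \<le> (1/4) ^ n * e" using n(2) e by (intro mult_right_mono) auto
    then show ?thesis using \<rho>(2) by (simp add: algebra_simps)
  qed
  moreover have "separated e \<inter> {h - \<rho><..<h + \<rho>} = {}"
  proof -
    have "s \<notin> separated e" if "h - \<rho> < s" "s < h + \<rho>" for s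
    proof -
      have "a + s * b = b * (s - h)" using b by (simp add: h_def field_simps)
      then have "\<bar>a + s * b\<bar> = b * \<bar>s - h\<bar>" using b by (simp add: abs_mult)
      also have "\<dots> < b * \<rho>" using that b by (intro mult_strict_left_mono) auto
      also have "\<dots> = e" using b by (simp add: \<rho>_def)
      finally show ?thesis unfolding separated_def using ab(1,2) b
        by (smt (verit, best) mem_Collect_eq prod.inject)
    qed
    then show ?thesis by auto
  qed
  ultimately show "\<exists>h \<rho>. c \<le> h - \<rho> \<and> h + \<rho> \<le> d \<and> e / 16 * (d - c) \<le> 2 * \<rho> \<and>
      separated e \<inter> {h - \<rho><..<h + \<rho>} = {}" by blast
qed (use e in \<open>auto simp: separated_def\<close>)

lemma digit_diffs_zero_pad: "a \<in> digit_diffs n \<Longrightarrow> a \<in> digit_diffs (n + k)"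
proof (induction n arbitrary: a)
  case 0
  have "0 \<in> digit_diffs k" for k by (induction k) force+
  then show ?case using 0 by simp
next
  case (Suc n)
  then show ?case by auto
qed

lemma digit_diffs_shift: "a \<in> digit_diffs n \<Longrightarrow> 4 ^ k * a \<in> digit_diffs (n + k)"
proof (induction k)
  case (Suc k)
  then show ?case using digit_diffs_Suc_I[of "4 ^ k * a" "n + k" 0] by (simp add: mult.assoc)
qed simp

text \<open>Multiplying \<open>b\<close> by \<open>4\<^sup>k\<close> appends zero digits, so near coincidences for \<open>4\<^sup>k t\<close> are also near
  coincidences for \<open>t\<close>; this reduces \<open>0 < t \<le> 2\<close> to \<open>1/2 \<le> t \<le> 2\<close>.\<close>

lemma shadow_null_AE:
  "negligible {t \<in> {0..2}. measure lebesgue (shadow (1/4) t) \<noteq> 0}"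
proof -
  define N where "N = {0} \<union> (\<Union>k j. (\<lambda>s. s / 4 ^ k) ` separated (1 / real (Suc j)))"
  have "negligible ((\<lambda>s. s / 4 ^ k) ` separated (1 / real (Suc j)))" for k j
    by (rule negligible_differentiable_image_negligible)
      (auto intro!: separated_negligible bounded_linear_imp_differentiable_on bounded_linear_divide)
  then have "negligible N"
    unfolding N_def by (intro negligible_Un negligible_Union negligible_countable_Union) auto
  moreover have "measure lebesgue (shadow (1/4) t) = 0" if t: "t \<in> {0..2}" "t \<notin> N" for t
  proof -
    have t0: "0 < t" "t \<le> 2" using t by (auto simp: N_def less_le)
    obtain k where k: "1/2 \<le> 4 ^ k * t" "4 ^ k * t \<le> 2"
    proof -
      define P where "P k \<longleftrightarrow> 1/2 \<le> 4 ^ k * t" for k :: nat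
      obtain M where "1 / t < 4 ^ M" using real_arch_pow[of 4 "1 / t"] by auto
      then have "P M" using t0 by (simp add: P_def field_simps)
      then have least: "P (LEAST k. P k)" by (rule LeastI)
      show ?thesis
      proof (cases "LEAST k. P k")
        case 0
        then show ?thesis using that[of 0] least t0 by (simp add: P_def)
      next
        case (Suc m)
        then have "\<not> P m" using not_less_Least[of m P] by simp
        then have "4 ^ m * t \<le> 1/2" by (simp add: P_def del: times_divide_eq_left times_divide_eq_right)
        moreover have "4 ^ Suc m * t = 4 * (4 ^ m * t)" by simp
        ultimately have "4 ^ Suc m * t \<le> 2" by argo
        moreover have "1/2 \<le> 4 ^ Suc m * t" using least unfolding Suc unfolding P_def .
        ultimately show ?thesis by (intro that[of "Suc m"])
      qed
    qed
    show ?thesis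
    proof (rule shadow_null_of_small_differences)
      fix e :: real assume e: "e > 0"
      obtain j where j: "1 / real (Suc j) < e" using nat_approx_posE[OF e] by blast
      have "t = (4 ^ k * t) / 4 ^ k" by simp
      then have "4 ^ k * t \<notin> separated (1 / real (Suc j))"
        using t(2) unfolding N_def by blast
      then obtain n a b where ab: "a \<in> digit_diffs n" "b \<in> digit_diffs n" "(a, b) \<noteq> (0, 0)"
          "\<bar>a + 4 ^ k * t * b\<bar> < 1 / real (Suc j)"
        using k unfolding separated_def by (auto simp: not_le)
      have "a \<in> digit_diffs (n + k)" "4 ^ k * b \<in> digit_diffs (n + k)" "(a, 4 ^ k * b) \<noteq> (0, 0)"
        using ab digit_diffs_zero_pad digit_diffs_shift by auto
      moreover have "\<bar>a + t * (4 ^ k * b)\<bar> < e" using ab(4) j by (simp add: algebra_simps)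
      ultimately show "\<exists>n. \<exists>a\<in>digit_diffs n. \<exists>b\<in>digit_diffs n. (a, b) \<noteq> (0, 0) \<and> \<bar>a + t * b\<bar> < e" by blast
    qed
  qed
  ultimately show ?thesis by (elim negligible_subset) blast
qed

lemma shadow_null_AE_le_quarter:
  assumes r: "0 < r" "r \<le> 1/4"
  shows "negligible {t \<in> {0..2}. measure lebesgue (shadow r t) \<noteq> 0}"
proof (cases "r = 1/4")
  case True
  then show ?thesis using shadow_null_AE by (simp only:)
next
  case False
  then show ?thesis using r shadow_null_small_ratio by simp
qed

section \<open>From shadows to the sum with an arc\<close>

text \<open>An arc of the unit circle is described by its abscissa \<open>circ y\<close> as a function of the height \<open>y\<close>.
  The bound \<open>y \<le> 3/4\<close> leaves room beyond \<open>1 / sqrt 2\<close>, where the octants end.\<close>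

definition circ :: "real \<Rightarrow> real" where "circ y = sqrt (1 - y\<^sup>2)"

text \<open>The negative of the derivative of \<open>circ\<close>.\<close>

definition slope :: "real \<Rightarrow> real" where "slope y = y / circ y"

lemma circ_ge_half:
  assumes "0 \<le> y" "y \<le> 3/4"
  shows "1/2 \<le> circ y"
proof -
  have "y\<^sup>2 \<le> (3/4)\<^sup>2" using assms by (intro power_mono)
  then have "(1/2)\<^sup>2 \<le> 1 - y\<^sup>2" by (simp add: power2_eq_square)
  then show ?thesis unfolding circ_def by (rule real_le_rsqrt)
qed

lemma circ_square: "0 \<le> y \<Longrightarrow> y \<le> 3/4 \<Longrightarrow> (circ y)\<^sup>2 = 1 - y\<^sup>2"
  unfolding circ_def using abs_square_le_1[of y] by simp

text \<open>A Taylor estimate of second order. The lower bound \<open>1/2\<close> on \<open>circ\<close> supplies the constant.\<close>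

lemma circ_linearization:
  assumes "0 \<le> h" "h \<le> y" "y \<le> 3/4"
  shows "\<bar>circ (y - h) - circ y - h * slope y\<bar> \<le> 5 * h\<^sup>2"
proof -
  define A B where "A = circ y" and "B = circ (y - h)"
  have A: "1/2 \<le> A" "A\<^sup>2 = 1 - y\<^sup>2" and B: "1/2 \<le> B" "B\<^sup>2 = 1 - (y - h)\<^sup>2"
    using assms circ_ge_half circ_square by (auto simp: A_def B_def)
  have diff: "(A - B) * (A + B) = - h * (2 * y - h)"
    using A(2) B(2) by (simp add: power2_eq_square algebra_simps)
  have "\<bar>A - B\<bar> \<le> \<bar>A - B\<bar> * (A + B)" using A B by (simp add: mult_le_cancel_left1)
  also have "\<dots> = \<bar>(A - B) * (A + B)\<bar>" using A B by (simp add: abs_mult)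
  also have "\<dots> = h * (2 * y - h)" unfolding diff using assms by (simp add: abs_mult)
  also have "\<dots> \<le> h * (3/2)" using assms by (intro mult_left_mono) auto
  finally have AB: "\<bar>A - B\<bar> \<le> h * (3/2)" .
  define N where "N = h * y * (A - B) - h\<^sup>2 * A"
  have "B - A - h * slope y = N / (A * (A + B))"
  proof -
    have "(B - A - h * slope y) * (A * (A + B)) = - ((A - B) * (A + B)) * A - h * y * (A + B)"
      using A(1) by (simp add: slope_def A_def[symmetric] field_simps)
    also have "\<dots> = N" unfolding diff N_def by (simp add: power2_eq_square algebra_simps)
    finally show ?thesis using A(1) B(1) by (simp add: eq_divide_eq)
  qed
  moreover have "\<bar>N / (A * (A + B))\<bar> \<le> \<bar>N\<bar> / (1/2)"
  proof -
    have "1/2 * 1 \<le> A * (A + B)" using A(1) B(1) by (intro mult_mono) auto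
    then show ?thesis unfolding abs_divide by (intro divide_left_mono) auto
  qed
  moreover have "\<bar>N\<bar> \<le> 5/2 * h\<^sup>2"
  proof -
    have "\<bar>N\<bar> \<le> \<bar>h * y * (A - B)\<bar> + \<bar>h\<^sup>2 * A\<bar>" unfolding N_def by (rule abs_triangle_ineq4)
    also have "\<bar>h * y * (A - B)\<bar> \<le> h * (3/4) * (h * (3/2))"
      unfolding abs_mult using assms AB by (intro mult_mono) auto
    also have "\<bar>h\<^sup>2 * A\<bar> \<le> h\<^sup>2 * 1"
    proof -
      have "A \<le> 1" unfolding A_def circ_def by simp
      then show ?thesis unfolding abs_mult using A(1) by (intro mult_mono) auto
    qed
    finally have "\<bar>N\<bar> \<le> 17/8 * h\<^sup>2" by (simp add: power2_eq_square algebra_simps)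
    also have "\<dots> \<le> 5/2 * h\<^sup>2" by (intro mult_right_mono) auto
    finally show ?thesis .
  qed
  ultimately show ?thesis by (simp add: A_def B_def)
qed

text \<open>For \<open>\<delta> = 0\<close>, the section at height \<open>y\<close> is the shadow of \<open>C\<close> along the tangent of the circle at
  height \<open>y\<close>; in general it is the \<open>\<delta>\<close>-neighbourhood of this shadow.\<close>

definition thick :: "real \<Rightarrow> real \<Rightarrow> (real \<times> real) set" where
  "thick r \<delta> = {(z + e, y) | z e y. y \<in> {0..3/4} \<and> z \<in> shadow r (slope y) \<and> \<bar>e\<bar> \<le> \<delta>}"

lemma continuous_on_slope: "continuous_on {0..3/4} slope"
proof -
  have "sqrt (1 - y\<^sup>2) \<noteq> 0" if "y \<in> {0..3/4}" for y
    using circ_ge_half[of y] that by (auto simp: circ_def)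
  then show ?thesis unfolding slope_def circ_def
    by (intro continuous_intros) auto
qed

lemma compact_thick:
  assumes r: "0 < r" "r < 1/2"
  shows "compact (thick r \<delta>)"
proof -
  let ?D = "{0..3/4::real} \<times> cantor_K r \<times> cantor_K r \<times> {-\<delta>..\<delta>}"
  let ?f = "\<lambda>(y, a, b, e). (a + slope y * b + e, y)"
  have "compact ?D" using cantor_K(2)[OF r] by (intro compact_Times) auto
  moreover have "continuous_on ?D ?f"
    unfolding case_prod_beta
    by (intro continuous_intros continuous_on_compose2[OF continuous_on_slope]) auto
  moreover have "thick r \<delta> = ?f ` ?D"
  proof (intro equalityI subsetI)
    fix p assume "p \<in> thick r \<delta>"
    then obtain a b e y where *: "y \<in> {0..3/4}" "a \<in> cantor_K r" "b \<in> cantor_K r" "\<bar>e\<bar> \<le> \<delta>"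
      "p = (a + slope y * b + e, y)" by (auto simp: thick_def shadow_def)
    then have "(y, a, b, e) \<in> ?D" "p = ?f (y, a, b, e)" by auto
    then show "p \<in> ?f ` ?D" by blast
  next
    fix p assume "p \<in> ?f ` ?D"
    then obtain w where w: "w \<in> ?D" "p = ?f w" by blast
    obtain y a b e where "w = (y, a, b, e)" by (metis prod_cases4)
    with w have *: "y \<in> {0..3/4}" "a \<in> cantor_K r" "b \<in> cantor_K r" "\<bar>e\<bar> \<le> \<delta>"
      "p = (a + slope y * b + e, y)" by auto
    moreover have "a + slope y * b \<in> shadow r (slope y)" using * by (auto simp: shadow_def)
    ultimately show "p \<in> thick r \<delta>" unfolding thick_def by blast
  qed
  ultimately show ?thesis using compact_continuous_image[of ?D ?f] by simp
qed

lemma emeasure_compact_slices: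
  fixes S :: "(real \<times> real) set"
  assumes "compact S"
  shows "emeasure lborel S = (\<integral>\<^sup>+y. emeasure lborel ((\<lambda>x. (x, y)) -` S) \<partial>lborel)"
proof -
  have "S \<in> sets (lborel \<Otimes>\<^sub>M lborel)"
    unfolding lborel_prod using borel_compact[OF assms] by simp
  then show ?thesis
    using lborel_pair.emeasure_pair_measure_alt2[of S] by (simp add: lborel_prod)
qed

text \<open>The inverse \<open>t \<mapsto> t / sqrt (1 + t\<^sup>2)\<close> of \<open>slope\<close> is differentiable, so it maps null sets to null
  sets.\<close>

lemma slope_null_AE:
  assumes r: "0 < r" "r \<le> 1/4"
  shows "AE y in lborel. y \<in> {0..3/4} \<longrightarrow> measure lebesgue (shadow r (slope y)) = 0"
proof -
  let ?N = "{t \<in> {0..2}. measure lebesgue (shadow r t) \<noteq> 0}"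
  let ?f = "\<lambda>t. t / sqrt (1 + t\<^sup>2)"
  have "?f differentiable at t" for t :: real
  proof -
    have "0 < 1 + t\<^sup>2" by (simp add: add_pos_nonneg)
    then have "(?f has_real_derivative ((sqrt (1 + t\<^sup>2) - t * (inverse (sqrt (1 + t\<^sup>2)) / 2 * (2 * t))) /
        (sqrt (1 + t\<^sup>2) * sqrt (1 + t\<^sup>2)))) (at t)"
      by (auto intro!: derivative_eq_intros)
    then show ?thesis using real_differentiable_def by blast
  qed
  then have "?f differentiable_on ?N"
    by (simp add: differentiable_at_imp_differentiable_on)
  then have "negligible (?f ` ?N)"
    using shadow_null_AE_le_quarter[OF r] by (intro negligible_differentiable_image_negligible) auto
  moreover have "{y. \<not> (y \<in> {0..3/4} \<longrightarrow> measure lebesgue (shadow r (slope y)) = 0)} \<subseteq> ?f ` ?N"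
  proof
    fix y assume "y \<in> {y. \<not> (y \<in> {0..3/4} \<longrightarrow> measure lebesgue (shadow r (slope y)) = 0)}"
    then have y: "0 \<le> y" "y \<le> 3/4" "measure lebesgue (shadow r (slope y)) \<noteq> 0" by auto
    note a = circ_ge_half[OF y(1,2)] circ_square[OF y(1,2)]
    have "slope y \<le> (3/4) / (1/2)" unfolding slope_def using a y by (intro frac_le) auto
    then have "slope y \<le> 2" by simp
    moreover have "0 \<le> slope y" using y a by (simp add: slope_def)
    ultimately have "slope y \<in> ?N" using y(3) by simp
    moreover have "y = ?f (slope y)"
    proof -
      have "1 + (slope y)\<^sup>2 = ((circ y)\<^sup>2 + y\<^sup>2) / (circ y)\<^sup>2"
        using a(1) by (simp add: slope_def power_divide add_divide_distrib)
      also have "\<dots> = (1 / circ y)\<^sup>2" unfolding a(2) by (simp add: power_divide a(2))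
      finally have "sqrt (1 + (slope y)\<^sup>2) = 1 / circ y" using a(1) by simp
      then show ?thesis using a(1) by (simp add: slope_def)
    qed
    ultimately show "y \<in> ?f ` ?N" by blast
  qed
  ultimately have "negligible {y. \<not> (y \<in> {0..3/4} \<longrightarrow> measure lebesgue (shadow r (slope y)) = 0)}"
    by (rule negligible_subset)
  then have "AE y in lebesgue. y \<in> {0..3/4} \<longrightarrow> measure lebesgue (shadow r (slope y)) = 0"
    unfolding negligible_iff_null_sets by (rule AE_I') simp
  then show ?thesis by (simp only: AE_completion_iff)
qed

lemma thick_0_null:
  assumes r: "0 < r" "r \<le> 1/4"
  shows "emeasure lborel (thick r 0) = 0"
proof -
  have r': "r < 1/2" using r by simp
  have slice: "(\<lambda>x. (x, y)) -` thick r 0 = (if y \<in> {0..3/4} then shadow r (slope y) else {})" for y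
    by (auto simp: thick_def)
  have "AE y in lborel. emeasure lborel ((\<lambda>x. (x, y)) -` thick r 0) = 0"
    using slope_null_AE[OF r]
  proof eventually_elim
    case (elim y)
    have "emeasure lborel (shadow r t) = measure lebesgue (shadow r t)" for t
      using emeasure_eq_measure2[OF shadow_lmeasurable[OF r(1) r', of t]]
        borel_compact[OF compact_shadow[OF r(1) r', of t]] by simp
    then show ?case unfolding slice using elim by simp
  qed
  then have "(\<integral>\<^sup>+y. emeasure lborel ((\<lambda>x. (x, y)) -` thick r 0) \<partial>lborel) = (\<integral>\<^sup>+y. 0 \<partial>(lborel::real measure))"
    by (rule nn_integral_cong_AE)
  then show ?thesis using emeasure_compact_slices[OF compact_thick[OF r(1) r']] by simp
qed

lemma thick_tendsto_0:
  assumes r: "0 < r" "r \<le> 1/4"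
  shows "(\<lambda>m. emeasure lborel (thick r (5 * r ^ m))) \<longlonglongrightarrow> 0"
proof -
  have r': "r < 1/2" using r by simp
  let ?A = "\<lambda>m. thick r (5 * r ^ m)"
  have "range ?A \<subseteq> sets lborel" using borel_compact[OF compact_thick[OF r(1) r']] by auto
  moreover have "decseq ?A"
  proof (rule decseq_SucI)
    fix m
    have "5 * r ^ Suc m \<le> 5 * r ^ m" using r by (simp add: mult_left_le_one_le)
    then show "?A (Suc m) \<le> ?A m" unfolding thick_def by fastforce
  qed
  moreover have "emeasure lborel (?A m) \<noteq> \<infinity>" for m
    using emeasure_compact_finite[OF compact_thick[OF r(1) r']] by (simp add: less_top)
  ultimately have "(\<lambda>m. emeasure lborel (?A m)) \<longlonglongrightarrow> emeasure lborel (\<Inter>m. ?A m)"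
    by (rule Lim_emeasure_decseq)
  moreover have "(\<Inter>m. ?A m) = thick r 0"
  proof
    show "(\<Inter>m. ?A m) \<subseteq> thick r 0"
    proof
      fix p assume p: "p \<in> (\<Inter>m. ?A m)"
      obtain w y where wy: "p = (w, y)" by (cases p)
      have y: "y \<in> {0..3/4}" using p wy by (auto simp: thick_def)
      have "w \<in> closure (shadow r (slope y))"
        unfolding closure_approachable
      proof (intro allI impI)
        fix e :: real assume "e > 0"
        then obtain m where m: "r ^ m < e / 5" using real_arch_pow_inv[of "e / 5" r] r by auto
        have "(w, y) \<in> thick r (5 * r ^ m)" using p wy by blast
        then obtain z where z: "z \<in> shadow r (slope y)" "\<bar>w - z\<bar> \<le> 5 * r ^ m"
          unfolding thick_def by auto
        then show "\<exists>z\<in>shadow r (slope y). dist z w < e"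
          using m by (intro bexI[of _ z]) (auto simp: dist_real_def)
      qed
      then have "w \<in> shadow r (slope y)"
        using compact_imp_closed[OF compact_shadow[OF r(1) r']] by simp
      then show "p \<in> thick r 0" using y wy by (auto simp: thick_def)
    qed
    have "thick r 0 \<subseteq> ?A m" for m
    proof -
      have "0 \<le> 5 * r ^ m" using r by simp
      then show ?thesis unfolding thick_def by fastforce
    qed
    then show "thick r 0 \<subseteq> (\<Inter>m. ?A m)" by blast
  qed
  ultimately show ?thesis using thick_0_null[OF r] by simp
qed

text \<open>Up to translation and for large \<open>m\<close>, this contains the sum of one level \<open>m\<close> square of \<open>C\<close> with the arc: at each height
  a thickened shadow, scaled by \<open>r\<^sup>m\<close> and moved to the abscissa of the arc.\<close>

definition bent :: "real \<Rightarrow> nat \<Rightarrow> (real \<times> real) set" where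
  "bent r m = (\<lambda>(x, y). (circ y + r ^ m * x, y)) ` thick r (5 * r ^ m)"

lemma compact_bent:
  assumes r: "0 < r" "r < 1/2"
  shows "compact (bent r m)"
  unfolding bent_def circ_def case_prod_beta
  by (intro compact_continuous_image compact_thick[OF r] continuous_intros)

text \<open>The set \<open>bent\<close> is a nonlinear shear of \<open>thick\<close>, whose horizontal sections are only translated and
  scaled by \<open>r\<^sup>m\<close>.\<close>

lemma emeasure_bent:
  assumes r: "0 < r" "r < 1/2"
  shows "emeasure lborel (bent r m) = ennreal (r ^ m) * emeasure lborel (thick r (5 * r ^ m))"
proof -
  let ?T = "thick r (5 * r ^ m)"
  have sets: "(\<lambda>x. (x, y)) -` S \<in> sets borel" if "compact S" for S :: "(real \<times> real) set" and y
  proof -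
    have "S \<in> sets (lborel \<Otimes>\<^sub>M lborel)"
      unfolding lborel_prod using borel_compact[OF that] by simp
    then show ?thesis using sets_Pair2[of S lborel lborel y] by simp
  qed
  have "(\<lambda>x. (x, y)) -` bent r m = (\<lambda>x. circ y + r ^ m * x) ` ((\<lambda>x. (x, y)) -` ?T)" for y
    by (auto simp: bent_def)
  then have slice: "emeasure lborel ((\<lambda>x. (x, y)) -` bent r m) =
      ennreal (r ^ m) * emeasure lborel ((\<lambda>x. (x, y)) -` ?T)" for y
    using emeasure_lebesgue_affine[of "r ^ m" "circ y" "(\<lambda>x. (x, y)) -` ?T"] r
      sets[OF compact_thick[OF r], of y "5 * r ^ m"] sets[OF compact_bent[OF r], of y m]
    by (simp add: add.commute abs_of_pos)
  have "?T \<in> sets (lborel \<Otimes>\<^sub>M lborel)"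
    unfolding lborel_prod using borel_compact[OF compact_thick[OF r]] by simp
  then have "(\<lambda>y. emeasure lborel ((\<lambda>x. (x, y)) -` ?T)) \<in> borel_measurable lborel"
    by (rule lborel_pair.measurable_emeasure_Pair2)
  then show ?thesis
    unfolding emeasure_compact_slices[OF compact_bent[OF r]] emeasure_compact_slices[OF compact_thick[OF r]] slice
    by (rule nn_integral_cmult)
qed

text \<open>The bound \<open>18/25\<close> exceeds \<open>1 / sqrt 2\<close>, so the arc contains an octant of the circle.\<close>

definition octant_sum :: "real \<Rightarrow> (real \<times> real) set" where
  "octant_sum r = {(a + circ w, b + w) | a b w. a \<in> cantor_K r \<and> b \<in> cantor_K r \<and> 0 \<le> w \<and> w \<le> 18/25}"

text \<open>The arc is linearized at the height \<open>y = w + r\<^sup>m b'\<close> of the given point above the corner of its square,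
  not at the height \<open>w\<close> above the point of \<open>C\<close>: this makes the slope depend on the horizontal line and
  the corner only, so that the section is a single shadow.\<close>

lemma octant_sum_covered:
  assumes r: "0 < r" "r < 1/2" and m: "r ^ m \<le> 3/100"
  shows "octant_sum r \<subseteq> (\<Union>z\<in>corners r m \<times> corners r m. (+) z ` bent r m)"
proof
  fix c assume "c \<in> octant_sum r"
  then obtain a b w where c: "c = (a + circ w, b + w)" "a \<in> cantor_K r" "b \<in> cantor_K r" "0 \<le> w" "w \<le> 18/25"
    by (auto simp: octant_sum_def)
  obtain p a' where a: "p \<in> corners r m" "a' \<in> cantor_K r" "a = p + r ^ m * a'"
    using c(2) cantor_K_cylinders[OF r, of m] by blast
  obtain q b' where b: "q \<in> corners r m" "b' \<in> cantor_K r" "b = q + r ^ m * b'"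
    using c(3) cantor_K_cylinders[OF r, of m] by blast
  have b': "0 \<le> b'" "b' \<le> 1" using b(2) cantor_K_subset[OF r] by auto
  define h y where "h = r ^ m * b'" and "y = w + h"
  have rm: "r ^ m > 0" using r by simp
  have h: "0 \<le> h" "h \<le> r ^ m" using rm b' by (auto simp: h_def mult_left_le)
  have y: "h \<le> y" "y \<le> 3/4" "0 \<le> y" using h m c by (auto simp: y_def)
  define e where "e = (circ w - circ y - h * slope y) / r ^ m"
  have "\<bar>e\<bar> \<le> 5 * r ^ m"
  proof -
    have "\<bar>circ w - circ y - h * slope y\<bar> \<le> 5 * h\<^sup>2"
      using circ_linearization[OF h(1) y(1,2)] by (simp add: y_def)
    also have "\<dots> \<le> 5 * (r ^ m)\<^sup>2" using h by (intro mult_left_mono power_mono) auto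
    finally show ?thesis using rm by (simp add: e_def power2_eq_square field_simps)
  qed
  then have "(a' + slope y * b' + e, y) \<in> thick r (5 * r ^ m)"
    using a b y by (auto simp: thick_def shadow_def)
  then have "(circ y + r ^ m * (a' + slope y * b' + e), y) \<in> bent r m"
    unfolding bent_def by force
  moreover have "r ^ m * e = circ w - circ y - h * slope y" using r by (simp add: e_def)
  then have "c = (p, q) + (circ y + r ^ m * (a' + slope y * b' + e), y)"
    by (simp add: c a b y_def h_def algebra_simps)
  ultimately show "c \<in> (\<Union>z\<in>corners r m \<times> corners r m. (+) z ` bent r m)"
    using a(1) b(1) by blast
qed

lemma octant_sum_negligible:
  assumes r: "0 < r" "r \<le> 1/4"
  shows "negligible (octant_sum r)"
proof -
  have r': "r < 1/2" using r by simp
  have bound: "emeasure lebesgue (octant_sum r) \<le> emeasure lborel (thick r (5 * r ^ m))"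
    if m: "r ^ m \<le> 3/100" for m
  proof -
    let ?Z = "corners r m \<times> corners r m"
    have B: "compact ((+) z ` bent r m)" for z
      by (intro compact_continuous_image continuous_intros compact_bent[OF r(1) r'])
    have "emeasure lebesgue (octant_sum r) \<le> emeasure lebesgue (\<Union>z\<in>?Z. (+) z ` bent r m)"
      using B octant_sum_covered[OF r(1) r' m]
      by (intro emeasure_mono sets.finite_UN) (auto intro: fmeasurableD lmeasurable_compact)
    also have "\<dots> \<le> (\<Sum>z\<in>?Z. emeasure lebesgue ((+) z ` bent r m))"
      using B by (intro emeasure_subadditive_finite) (auto intro!: fmeasurableD lmeasurable_compact)
    also have "\<dots> = (\<Sum>z\<in>?Z. emeasure lborel (bent r m))"
    proof (rule sum.cong[OF refl])
      fix z :: "real \<times> real"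
      have "emeasure lebesgue ((+) z ` bent r m) = emeasure lebesgue (bent r m)"
        using emeasure_lebesgue_affine[of 1 z "bent r m"] by (simp add: add.commute cong: image_cong_simp)
      then show "emeasure lebesgue ((+) z ` bent r m) = emeasure lborel (bent r m)"
        using borel_compact[OF compact_bent[OF r(1) r', of m]] by simp
    qed
    also have "\<dots> = ennreal (real (card ?Z) * r ^ m) * emeasure lborel (thick r (5 * r ^ m))"
      unfolding emeasure_bent[OF r(1) r'] using r
      by (simp add: ennreal_mult ennreal_of_nat_eq_real_of_nat mult.assoc)
    also have "\<dots> \<le> 1 * emeasure lborel (thick r (5 * r ^ m))"
    proof (rule mult_right_mono)
      have "card ?Z \<le> 2 ^ m * 2 ^ m"
        unfolding card_cartesian_product using card_corners_le by (intro mult_mono) auto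
      then have "real (card ?Z) \<le> real (2 ^ m * 2 ^ m)" by (simp only: of_nat_le_iff)
      then have "real (card ?Z) * r ^ m \<le> 4 ^ m * r ^ m"
        using r by (intro mult_right_mono) (auto simp flip: power_mult_distrib)
      also have "\<dots> = (4 * r) ^ m" by (simp add: power_mult_distrib)
      also have "\<dots> \<le> 1" using r by (intro power_le_one) auto
      finally show "ennreal (real (card ?Z) * r ^ m) \<le> 1" by (simp add: ennreal_le_1)
    qed simp
    finally show ?thesis by simp
  qed
  obtain M where M: "r ^ M < 3/100" using real_arch_pow_inv[of "3/100" r] r by auto
  have "emeasure lebesgue (octant_sum r) \<le> emeasure lborel (thick r (5 * r ^ m))" if "m \<ge> M" for m
  proof (rule bound)
    have "r ^ m \<le> r ^ M" using that r by (intro power_decreasing) auto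
    then show "r ^ m \<le> 3/100" using M by linarith
  qed
  then have "emeasure lebesgue (octant_sum r) \<le> 0"
    by (intro LIMSEQ_le_const[OF thick_tendsto_0[OF r]]) blast
  moreover have comp: "compact (octant_sum r)"
  proof -
    have "octant_sum r = (\<lambda>(a, b, w). (a + circ w, b + w)) ` (cantor_K r \<times> cantor_K r \<times> {0..18/25})"
      by (force simp: octant_sum_def)
    moreover have "compact \<dots>"
      unfolding case_prod_beta circ_def
      by (intro compact_continuous_image compact_Times cantor_K(2)[OF r(1) r'] continuous_intros compact_Icc)
    ultimately show ?thesis by simp
  qed
  moreover have "octant_sum r \<in> sets lebesgue" using comp by (intro fmeasurableD lmeasurable_compact)
  ultimately show ?thesis by (simp add: negligible_iff_emeasure0)
qed

section \<open>The eight octants\<close>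

text \<open>The Cantor square is invariant under the reflections in its midlines and in its diagonal, which
  permute the octants of the circle.\<close>

lemma cantor_A_octants:
  fixes r :: real
  assumes r: "0 < r" "r < 1/2"
  defines "R1 \<equiv> \<lambda>z::real\<times>real. (1 - fst z, snd z)" and "R2 \<equiv> \<lambda>z::real\<times>real. (fst z, 1 - snd z)"
    and "W \<equiv> \<lambda>z::real\<times>real. (snd z, fst z)"
  defines "A1 \<equiv> octant_sum r \<union> R1 ` octant_sum r"
  defines "A2 \<equiv> A1 \<union> R2 ` A1"
  shows "cantor_A r \<subseteq> A2 \<union> W ` A2"
proof
  have half: "(a + x, b + y) \<in> A2"
    if ab: "a \<in> cantor_K r" "b \<in> cantor_K r" and xy: "x\<^sup>2 + y\<^sup>2 = 1" "\<bar>y\<bar> \<le> \<bar>x\<bar>" for a b x y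
  proof -
    define a' b' where "a' = (if x < 0 then 1 - a else a)" and "b' = (if y < 0 then 1 - b else b)"
    have K: "a' \<in> cantor_K r" "b' \<in> cantor_K r"
      using ab cantor_K_reflect[OF r] by (auto simp: a'_def b'_def)
    have "1 - y\<^sup>2 = \<bar>x\<bar>\<^sup>2" using xy(1) by simp
    then have x: "circ \<bar>y\<bar> = \<bar>x\<bar>" by (simp add: circ_def)
    have "\<bar>y\<bar>\<^sup>2 \<le> \<bar>x\<bar>\<^sup>2" using xy(2) by (intro power_mono) auto
    then have "\<bar>y\<bar>\<^sup>2 \<le> (18/25)\<^sup>2" using xy(1) by (simp add: power2_eq_square)
    then have "\<bar>y\<bar> \<le> 18/25" by (rule power2_le_imp_le) simp
    then have P: "(a' + \<bar>x\<bar>, b' + \<bar>y\<bar>) \<in> octant_sum r"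
      using K x unfolding octant_sum_def by force
    have 1: "(a + x, b' + \<bar>y\<bar>) \<in> A1"
    proof (cases "x < 0")
      case True
      then have "(a + x, b' + \<bar>y\<bar>) = R1 (a' + \<bar>x\<bar>, b' + \<bar>y\<bar>)" by (simp add: R1_def a'_def)
      then show ?thesis using P unfolding A1_def by blast
    qed (use P in \<open>auto simp: A1_def a'_def\<close>)
    show ?thesis
    proof (cases "y < 0")
      case True
      then have "(a + x, b + y) = R2 (a + x, b' + \<bar>y\<bar>)" by (simp add: R2_def b'_def)
      then show ?thesis using 1 unfolding A2_def by blast
    qed (use 1 in \<open>auto simp: A2_def b'_def\<close>)
  qed
  fix c assume "c \<in> cantor_A r"
  then obtain a b x y where c: "c = (a + x, b + y)" "a \<in> cantor_K r" "b \<in> cantor_K r" "x\<^sup>2 + y\<^sup>2 = 1"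
    by (auto simp: cantor_A_def cantor_C_def unit_circle_def set_plus_def)
  show "c \<in> A2 \<union> W ` A2"
  proof (cases "\<bar>y\<bar> \<le> \<bar>x\<bar>")
    case True
    then show ?thesis using half c by blast
  next
    case False
    then have "(b + y, a + x) \<in> A2" using c by (intro half) auto
    moreover have "c = W (b + y, a + x)" by (simp add: W_def c)
    ultimately show ?thesis by blast
  qed
qed

lemma cantor_A_negligible:
  assumes r: "0 < r" "r \<le> 1/4"
  shows "negligible (cantor_A r)"
proof -
  have image: "negligible (f ` S)" if "negligible S" "\<And>z. (f has_derivative f') (at z)"
    for f f' :: "real \<times> real \<Rightarrow> real \<times> real" and S
  proof (rule negligible_differentiable_image_negligible[OF order_refl that(1)])
    show "f differentiable_on S"
      using that(2) by (meson differentiable_at_imp_differentiable_on differentiable_def)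
  qed
  have R1: "negligible ((\<lambda>z::real\<times>real. (1 - fst z, snd z)) ` S)" if "negligible S" for S
    by (rule image[OF that, of _ "\<lambda>z. (- fst z, snd z)"]) (auto intro!: derivative_eq_intros)
  have R2: "negligible ((\<lambda>z::real\<times>real. (fst z, 1 - snd z)) ` S)" if "negligible S" for S
    by (rule image[OF that, of _ "\<lambda>z. (fst z, - snd z)"]) (auto intro!: derivative_eq_intros)
  have W: "negligible ((\<lambda>z::real\<times>real. (snd z, fst z)) ` S)" if "negligible S" for S
    by (rule image[OF that, of _ "\<lambda>z. (snd z, fst z)"]) (auto intro!: derivative_eq_intros)
  have "r < 1/2" using r by simp
  from cantor_A_octants[OF r(1) this] show ?thesis
    by (rule negligible_subset[rotated]) (intro negligible_Un R1 R2 W octant_sum_negligible[OF r])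
qed

theorem corollary1p3:
  fixes r :: real
  assumes "0 < r" and "r < 1/2"
  shows "interior (cantor_A r) \<noteq> {} \<longleftrightarrow> r > 1/4"
proof
  assume int: "interior (cantor_A r) \<noteq> {}"
  show "r > 1/4"
  proof (rule ccontr)
    assume "\<not> r > 1/4"
    then have "negligible (interior (cantor_A r))"
      using cantor_A_negligible[OF assms(1)] interior_subset negligible_subset by (metis not_less)
    then show False using int open_not_negligible open_interior by blast
  qed
next
  assume "r > 1/4"
  then show "interior (cantor_A r) \<noteq> {}" using interior_cantor_A_nonempty assms(2) by blast
qed

end
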